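(* Let $d\ge1$, let $V$ be a finite-dimensional real inner product space and $\bar V_d=\mathbb{R}^d\times V$. The parametrized mapping space signature $\bar\Phi:\mathrm{Lip}_J(\square^d,V)\to\mathbf{H}_d((\bar V_d))$ is injective.
   Context: Notation: $\square^d=[0,1]^d$, $[k]=\{1,\dots,k\}$, $\Sigma_m$ is the symmetric group on $[m]$, $n=\dim V$, $e_{v,1},\dots,e_{v,n}$ is an orthonormal basis of $V$ and $e_{u,1},\dots,e_{u,d}$ one of $\mathbb{R}^d$. $\mathrm{Lip}(\square^d,V)$ is the set of Lipschitz maps $\mathbf{x}=(x_1,\dots,x_n):\square^d\to V$ (differentiable a.e.). $\mathcal{O}_{d,n}$ is the set of order-preserving injections $P:[d]\to[n]$; $J[\mathbf{x}_P](\mathbf{s})=\det(\partial x_{P(i)}/\partial s_j(\mathbf{s}))_{i,j\in[d]}$. Lipschitz maps $\mathbf{x},\mathbf{y}$ are Jacobian equivalent if $J[\mathbf{x}_P]=J[\mathbf{y}_P]$ a.e. for all $P\in\mathcal{O}_{d,n}$; $\mathrm{Lip}_J(\square^d,V)$ is the set of equivalence classes. For $\pi\in\Sigma_m$, $\Delta^m_\pi=\{0\le t_{\pi(1)}<\dots<t_{\pi(m)}\le1\}$; for $\boldsymbol\pi=(\pi_1,\dots,\pi_d)\in\Sigma_m^d$, $D^m_{\boldsymbol\pi}=\prod_{j=1}^d\Delta^m_{\pi_j}$ with coordinates $\mathbf{t}=(t_{i,j})_{i\in[m],j\in[d]}$, $(t_{1,j},\dots,t_{m,j})\in\Delta^m_{\pi_j}$,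 $\mathbf{t}_i=(t_{i,1},\dots,t_{i,d})$. For a finite-dimensional inner product space $E$: $\mathbf{T}_d^{(0)}(E)=\mathbb{R}$, $\mathbf{T}_d^{(m)}(E)=\prod_{\boldsymbol\pi\in\Sigma_m^d}(\Lambda^dE)^{\otimes m}$, and $\mathbf{H}_d((E))=\{(\mathbf{r}_m)_{m\ge0}\in\prod_m\mathbf{T}_d^{(m)}(E):\sum_m\|\mathbf{r}_m\|^2<\infty\}$. Let $W=\{U\}\cup\mathcal{O}_{d,n}$, where $U$ stands for the basis element $e^U=e_{u,1}\wedge\dots\wedge e_{u,d}$ and $P\in\mathcal{O}_{d,n}$ for $e^P=e_{v,P(1)}\wedge\dots\wedge e_{v,P(d)}$ of $\Lambda^d\bar V_d$. With $\bar{\mathbf{x}}(\mathbf{s})=(\mathbf{s},\mathbf{x}(\mathbf{s}))$ one has $J[\bar{\mathbf{x}}_U]=1$ and $J[\bar{\mathbf{x}}_P]=J[\mathbf{x}_P]$. $\bar\Phi(\mathbf{x})\in\mathbf{H}_d((\bar V_d))$ has level $0$ component $1$ and, for $m\ge1$, $\mathbf{P}=(P_1,\dots,P_m)\in W^m$, $\boldsymbol\pi\in\Sigma_m^d$, coordinate $\bar\Phi_m^{\mathbf{P},\boldsymbol\pi}(\mathbf{x})=\int_{D^m_{\boldsymbol\pi}}\prod_{i=1}^mJ[\bar{\mathbf{x}}_{P_i}](\mathbf{t}_i)\,d\mathbf{t}$ along $e^{P_1}\otimes\dots\otimes e^{P_m}$ in the $\boldsymbol\pi$ factor; all coordinates whose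 form index involves a basis element outside $W$ are $0$. Since it depends only on the Jacobian minors of $\mathbf{x}$, $\bar\Phi$ is well defined on $\mathrm{Lip}_J(\square^d,V)$. *)

theory Defs
  imports "HOL-Analysis.Analysis"
begin

text \<open>
  The index set \<open>[d]\<close> is the universe of a finite linearly ordered type \<open>'d\<close>, so that
  \<open>d = CARD('d) \<ge> 1\<close>. The space \<open>V\<close> is a type \<open>'v :: real_inner\<close> with an orthonormal basis
  \<open>e 1, \<dots>, e n\<close>; unlike the class \<open>euclidean_space\<close> this includes \<open>n = 0\<close>.
\<close>

definition orthonormal_basis :: "nat \<Rightarrow> (nat \<Rightarrow> 'v::real_inner) \<Rightarrow> bool" where
  "orthonormal_basis n e \<longleftrightarrow>
     (\<forall>i\<in>{1..n}. \<forall>j\<in>{1..n}. e i \<bullet> e j = (if i = j then 1 else 0)) \<and> span (e ` {1..n}) = UNIV"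

definition cube :: "(real ^ 'd::finite) set" where
  "cube = cbox 0 1"

text \<open>Maps defined on the cube only are represented by functions with value \<open>undefined\<close> outside it.\<close>

definition Lip :: "(real ^ 'd::finite \<Rightarrow> 'v::real_inner) set" where
  "Lip = {x \<in> extensional cube. \<exists>C. C-lipschitz_on cube x}"

text \<open>
  The minor \<open>J[f_I]\<close>, where \<open>f_I = (f_{I(1)}, \<dots>, f_{I(d)})\<close> collects coordinates of \<open>f\<close> with respect to the
  orthonormal family \<open>b\<close>. A Lipschitz map is differentiable almost everywhere; the value at the
  remaining points is fixed to be \<open>0\<close>. The matrix has the entries \<open>\<partial>f_{I(i)} / \<partial>s_j\<close>.
\<close>

definition J :: "('i \<Rightarrow> 'e::real_inner) \<Rightarrow> (real ^ 'd::finite \<Rightarrow> 'e) \<Rightarrow> ('d \<Rightarrow> 'i) \<Rightarrow> real ^ 'd \<Rightarrow> real" where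
  "J b f I s =
     (let fI = (\<lambda>s. \<chi> i. f s \<bullet> b (I i)) :: real ^ 'd \<Rightarrow> real ^ 'd in
      if fI differentiable (at s within cube)
      then det (jacobian fI (at s within cube)) else 0)"

definition ord_inj :: "nat \<Rightarrow> ('d::{finite,linorder} \<Rightarrow> nat) set" where
  "ord_inj n = {P. strict_mono P \<and> range P \<subseteq> {1..n}}"

definition jacobian_equiv ::
  "nat \<Rightarrow> (nat \<Rightarrow> 'v::real_inner) \<Rightarrow> (real ^ 'd::{finite,linorder} \<Rightarrow> 'v) rel" where
  "jacobian_equiv n e = {(x, y). x \<in> Lip \<and> y \<in> Lip \<and>
     (\<forall>P\<in>ord_inj n. AE s in lebesgue_on cube. J e x P s = J e y P s)}"

definition Lip_J ::
  "nat \<Rightarrow> (nat \<Rightarrow> 'v::real_inner) \<Rightarrow> (real ^ 'd::{finite,linorder} \<Rightarrow> 'v) set set" where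
  "Lip_J n e = Lip // jacobian_equiv n e"

text \<open>
  The product type \<open>real ^ 'd \<times> 'v\<close> carries the orthonormal basis given by the standard basis
  of the first factor (indices \<open>Inl j\<close>), followed by the basis \<open>e\<close> of the second
  (indices \<open>Inr k\<close>, \<open>k \<in> {1..n}\<close>).
\<close>

definition bar_basis :: "(nat \<Rightarrow> 'v::real_inner) \<Rightarrow> 'd::finite + nat \<Rightarrow> (real ^ 'd) \<times> 'v" where
  "bar_basis e = case_sum (\<lambda>j. (axis j 1, 0)) (\<lambda>k. (0, e k))"

fun index_less :: "'d::linorder + nat \<Rightarrow> 'd + nat \<Rightarrow> bool" where
  "index_less (Inl i) (Inl j) \<longleftrightarrow> i < j"
| "index_less (Inl i) (Inr k) \<longleftrightarrow> True"
| "index_less (Inr k) (Inl j) \<longleftrightarrow> False"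
| "index_less (Inr k) (Inr l) \<longleftrightarrow> k < l"

text \<open>
  A form index \<open>I\<close> stands for the element \<open>e^I = e_{I(1)} \<and> \<dots> \<and> e_{I(d)}\<close> of the orthonormal basis of
  the \<open>d\<close>-th exterior power of \<open>real ^ 'd \<times> 'v\<close> (with indices taken in increasing order). In \<open>W\<close>,
  the element \<open>U\<close> is \<open>Inl\<close>, and \<open>P \<in> ord_inj n\<close> is \<open>Inr \<circ> P\<close>.
\<close>

definition form_indices :: "nat \<Rightarrow> ('d::{finite,linorder} \<Rightarrow> 'd + nat) set" where
  "form_indices n = {I. monotone (<) index_less I \<and> range I \<subseteq> UNIV <+> {1..n}}"

definition W :: "nat \<Rightarrow> ('d::{finite,linorder} \<Rightarrow> 'd + nat) set" where
  "W n = insert Inl ((\<lambda>P. Inr \<circ> P) ` ord_inj n)"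

text \<open>
  Elements of the \<open>m\<close>-th level (a product, over \<open>d\<close>-tuples of permutations, of \<open>m\<close>-th tensor powers of
  the exterior power) are represented by their coordinates in the orthonormal basis of the
  elements \<open>e^{P 1} \<otimes> \<dots> \<otimes> e^{P m}\<close> in each of the factors. For \<open>m = 0\<close> there is exactly one coordinate.
\<close>

type_synonym 'd coord = "(nat \<Rightarrow> 'd \<Rightarrow> 'd + nat) \<times> ('d \<Rightarrow> nat \<Rightarrow> nat)"

definition coords :: "nat \<Rightarrow> nat \<Rightarrow> 'd::{finite,linorder} coord set" where
  "coords n m = ({1..m} \<rightarrow>\<^sub>E form_indices n) \<times> {\<pi>. \<forall>j. \<pi> j permutes {1..m}}"

definition T_level :: "nat \<Rightarrow> nat \<Rightarrow> ('d::{finite,linorder} coord \<Rightarrow> real) set" where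
  "T_level n m = coords n m \<rightarrow>\<^sub>E UNIV"

definition H :: "nat \<Rightarrow> (nat \<Rightarrow> 'd::{finite,linorder} coord \<Rightarrow> real) set" where
  "H n = {r. (\<forall>m. r m \<in> T_level n m) \<and> summable (\<lambda>m. \<Sum>k\<in>coords n m. (r m k)\<^sup>2)}"

text \<open>Only used for \<open>m \<ge> 1\<close>.\<close>

definition D :: "nat \<Rightarrow> ('d::finite \<Rightarrow> nat \<Rightarrow> nat) \<Rightarrow> (nat \<Rightarrow> real ^ 'd) set" where
  "D m \<pi> = {t \<in> {1..m} \<rightarrow>\<^sub>E UNIV. \<forall>j.
     0 \<le> t (\<pi> j 1) $ j \<and> (\<forall>k\<in>{1..<m}. t (\<pi> j k) $ j < t (\<pi> j (Suc k)) $ j) \<and> t (\<pi> j m) $ j \<le> 1}"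

text \<open>The completed product measure is Lebesgue measure on \<open>m\<close>-tuples of points of \<open>real ^ 'd\<close>.\<close>

definition signature ::
  "nat \<Rightarrow> (nat \<Rightarrow> 'v::real_inner) \<Rightarrow> (real ^ 'd::{finite,linorder} \<Rightarrow> 'v)
    \<Rightarrow> nat \<Rightarrow> 'd coord \<Rightarrow> real" where
  "signature n e x m = (\<lambda>(P, \<pi>) \<in> coords n m.
     if m = 0 then 1
     else if \<forall>i\<in>{1..m}. P i \<in> W n then
       (LINT t : D m \<pi> | completion (PiM {1..m} (\<lambda>_. lborel)).
          (\<Prod>i\<in>{1..m}. J (bar_basis e) (\<lambda>s. (s, x s)) (P i) (t i)))
     else 0)"

text \<open>The map induced on equivalence classes: the common value on all representatives.\<close>

definition signature_J ::
  "nat \<Rightarrow> (nat \<Rightarrow> 'v::real_inner) \<Rightarrow> (real ^ 'd::{finite,linorder} \<Rightarrow> 'v) set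
    \<Rightarrow> nat \<Rightarrow> 'd coord \<Rightarrow> real" where
  "signature_J n e c = the_elem (signature n e ` c)"

end

theory Submission
  imports Defs
begin

text \<open>
  For a minor \<open>J\<close> of \<open>x\<close>, put \<open>J\<close> in the first slot of a word and the constant minor \<open>U\<close>, which equals \<open>1\<close>,
  in the remaining ones. Summing the coordinates of the signature over all \<open>\<pi>\<close> whose order types
  force \<open>t_{i,j} < t_{1,j}\<close> for \<open>a_j\<close> prescribed indices \<open>i\<close> and integrating out all variables but \<open>t_1\<close>
  gives the moment of \<open>J\<close> against the monomial \<open>\<Prod>_j s_j^{a_j}\<close>. By the Stone--Weierstrass theorem a
  bounded function on the cube is determined almost everywhere by its moments, so the signature
  determines all minors.

  For square summability, the sets \<open>D m \<pi>\<close> are disjoint subsets of a cube of volume \<open>1\<close>, and permuting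
  the \<open>m\<close> points simultaneously in all coordinates moves \<open>D m \<pi>\<close> through \<open>m!\<close> of them. Hence each has
  volume at most \<open>1 / m!\<close>, so that the squares of their volumes sum to at most \<open>1 / m!\<close>.

  Rademacher's theorem is not needed: a minor is \<open>0\<close> by convention where the map is not differentiable,
  and it is a Borel function on the open cube.
\<close>

declare One_nat_def [simp del]

section \<open>Measurability and bounds for Jacobian determinants\<close>

text \<open>The chain rule along the line through \<open>s\<close> in direction
  \<open>axis j 1\<close>, read along the fixed sequence \<open>inverse (real (Suc k))\<close>. A
  countable limit of difference quotients yields both the measurability of the entries and their
  bound by a Lipschitz constant.\<close>

lemma jacobian_entry_tendsto:
  fixes g :: "real ^ 'd \<Rightarrow> real ^ 'c"
  assumes "g differentiable (at s)"
  shows "(\<lambda>k. (g (s + inverse (real (Suc k)) *\<^sub>R axis j 1) $ i - g s $ i) * real (Suc k))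
           \<longlonglongrightarrow> jacobian g (at s) $ i $ j"
proof -
  let ?w = "axis j 1 :: real ^ 'd" and ?A = "jacobian g (at s)"
  \<comment> \<open>The base point is written \<open>s + 0 *\<^sub>R ?w\<close> to fit the
    composition with the line at parameter 0.\<close>
  have "(g has_derivative (\<lambda>h. ?A *v h)) (at (s + 0 *\<^sub>R ?w))"
    using assms by (simp add: jacobian_works)
  moreover have "((\<lambda>r. s + r *\<^sub>R ?w) has_derivative (\<lambda>r. r *\<^sub>R ?w)) (at 0)"
    by (auto intro!: derivative_eq_intros)
  ultimately have "((\<lambda>r. g (s + r *\<^sub>R ?w)) has_derivative (\<lambda>r. ?A *v (r *\<^sub>R ?w))) (at 0)"
    using has_derivative_compose by fastforce
  then have "((\<lambda>r. g (s + r *\<^sub>R ?w) $ i) has_derivative (\<lambda>r. (?A *v (r *\<^sub>R ?w)) $ i)) (at 0)"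
    by (rule bounded_linear.has_derivative[OF bounded_linear_vec_nth])
  moreover have "(?A *v (r *\<^sub>R ?w)) $ i = r * (?A $ i $ j)" for r
    by (simp add: matrix_vector_mult_scaleR matrix_vector_mul_component inner_axis)
  ultimately have "((\<lambda>r. g (s + r *\<^sub>R ?w) $ i) has_field_derivative ?A $ i $ j) (at 0)"
    by (simp add: has_field_derivative_def mult.commute[of "?A $ i $ j"] mult_commute_abs)
  then have "(\<lambda>r. (g (s + r *\<^sub>R ?w) $ i - g s $ i) / r) \<midarrow>0\<rightarrow> ?A $ i $ j"
    by (simp add: DERIV_def)
  moreover have "filterlim (\<lambda>k. inverse (real (Suc k))) (at 0) sequentially"
    using LIMSEQ_inverse_real_of_nat by (auto simp: filterlim_at eventually_sequentially)
  ultimately have "(\<lambda>k. (g (s + inverse (real (Suc k)) *\<^sub>R ?w) $ i - g s $ i) / inverse (real (Suc k)))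
           \<longlonglongrightarrow> ?A $ i $ j"
    by (rule filterlim_compose)
  then show ?thesis
    by (simp add: divide_inverse)
qed

text \<open>The only possible derivative at \<open>s\<close> is the matrix of limits of difference
  quotients, which is a Borel function of \<open>s\<close>. Differentiability becomes an estimate
  for the remainder of this candidate, and continuity of \<open>g\<close> lets all quantifiers in it
  range over countable sets.\<close>

lemma borel_measurable_det_jacobian:
  fixes g :: "real ^ 'd \<Rightarrow> real ^ 'd"
  assumes g: "continuous_on UNIV g"
  shows "(\<lambda>s. if g differentiable (at s) then det (jacobian g (at s)) else 0) \<in> borel_measurable borel"
proof -
  \<comment> \<open>\<open>lim\<close> is total. Where the quotients diverge it takes some value,
    which is harmless because the remainder estimate below then fails.\<close>
  define a where "a i j s =
      lim (\<lambda>k. (g (s + inverse (real (Suc k)) *\<^sub>R axis j 1) $ i - g s $ i) * real (Suc k))" for i j s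
  define A where "A s = (\<chi> i j. a i j s)" for s
  have [measurable]: "a i j \<in> borel_measurable borel" for i j
    unfolding a_def
    by (intro borel_measurable_lim_metric borel_measurable_continuous_onI continuous_intros
        continuous_on_compose2[OF g]) auto
  have jac: "jacobian g (at s) = A s" if "g differentiable (at s)" for s
    using limI[OF jacobian_entry_tendsto[OF that]] by (simp add: A_def a_def vec_eq_iff)
  obtain Q :: "(real ^ 'd) set" where Q: "countable Q" "\<And>X. open X \<Longrightarrow> X \<noteq> {} \<Longrightarrow> \<exists>w\<in>Q. w \<in> X"
    using countable_dense_exists by metis
  \<comment> \<open>The remainder of the first-order expansion with candidate derivative
    \<open>A s\<close> and increment \<open>w\<close>.\<close>
  define B where "B s w = g (s + w) - g s - A s *v w" for s w
  have [measurable]: "(\<lambda>s. B s w) \<in> borel_measurable borel" for w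
  proof -
    have "(\<lambda>s. g (s + w) - g s) \<in> borel_measurable borel"
      by (intro borel_measurable_continuous_onI continuous_intros continuous_on_compose2[OF g]) auto
    moreover have "(\<lambda>s. A s *v w) \<in> borel_measurable borel"
      by (subst borel_measurable_euclidean_space)
        (auto simp: matrix_vector_mult_def A_def Basis_vec_def inner_axis)
    ultimately show ?thesis
      unfolding B_def by measurable
  qed
  have B_cont: "continuous_on UNIV (B s)" for s
    unfolding B_def
    by (intro continuous_intros continuous_on_compose2[OF g] matrix_vector_mult_linear_continuous_on) auto
  \<comment> \<open>The usual epsilon and delta are replaced by reciprocals of positive integers,
    and the increments are taken from the countable dense set \<open>Q\<close>.\<close>
  have diff: "g differentiable (at s) \<longleftrightarrow>
      (\<forall>k. \<exists>l. \<forall>w\<in>Q. norm w < inverse (real (Suc l)) \<longrightarrow> norm (B s w) \<le> inverse (real (Suc k)) * norm w)"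
    (is "?L \<longleftrightarrow> ?R") for s
  proof
    assume ?L
    then have *: "(g has_derivative (\<lambda>h. A s *v h)) (at s)"
      using jac jacobian_works by metis
    show ?R
    proof
      fix k
      obtain d where "d > 0" and d: "\<And>y. norm (y - s) < d \<Longrightarrow>
          norm (g y - g s - A s *v (y - s)) \<le> inverse (real (Suc k)) * norm (y - s)"
        using * unfolding has_derivative_within_alt
        by (metis UNIV_I inverse_positive_iff_positive of_nat_0_less_iff zero_less_Suc)
      obtain l where "inverse (real (Suc l)) < d"
        using reals_Archimedean[OF \<open>d > 0\<close>] by auto
      then show "\<exists>l. \<forall>w\<in>Q. norm w < inverse (real (Suc l)) \<longrightarrow> norm (B s w) \<le> inverse (real (Suc k)) * norm w"
        using d[of "s + w" for w] by (intro exI[of _ l]) (auto simp: B_def)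
    qed
  next
    assume R: ?R
    have "(g has_derivative (\<lambda>h. A s *v h)) (at s)"
      unfolding has_derivative_within_alt
    proof (intro conjI allI impI matrix_vector_mul_bounded_linear)
      fix \<epsilon> :: real assume "\<epsilon> > 0"
      obtain k where k: "inverse (real (Suc k)) < \<epsilon>"
        using reals_Archimedean[OF \<open>\<epsilon> > 0\<close>] by auto
      obtain l where l: "\<And>w. w \<in> Q \<Longrightarrow> norm w < inverse (real (Suc l)) \<Longrightarrow>
          norm (B s w) \<le> inverse (real (Suc k)) * norm w"
        using R by metis
      \<comment> \<open>The increments that violate the estimate form an open set, by continuity of
        \<open>B s\<close>. If it were nonempty it would meet \<open>Q\<close>, where the estimate
        is known.\<close>
      define X where "X = {w. norm w < inverse (real (Suc l))} \<inter> {w. inverse (real (Suc k)) * norm w < norm (B s w)}"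
      have "open X"
        unfolding X_def by (intro open_Int open_Collect_less continuous_intros continuous_on_norm B_cont)
      then have "X = {}"
        using Q(2)[of X] l by (fastforce simp: X_def)
      have "norm (g y - g s - A s *v (y - s)) \<le> \<epsilon> * norm (y - s)" if "norm (y - s) < inverse (real (Suc l))" for y
      proof -
        have "y - s \<notin> X" using \<open>X = {}\<close> by simp
        then have "norm (B s (y - s)) \<le> inverse (real (Suc k)) * norm (y - s)"
          using that by (auto simp: X_def)
        also have "\<dots> \<le> \<epsilon> * norm (y - s)"
          using k by (intro mult_right_mono) auto
        finally show ?thesis by (simp add: B_def)
      qed
      then show "\<exists>d>0. \<forall>y\<in>UNIV. norm (y - s) < d \<longrightarrow> norm (g y - g s - A s *v (y - s)) \<le> \<epsilon> * norm (y - s)"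
        by (intro exI[of _ "inverse (real (Suc l))"]) auto
    qed
    then show ?L by (auto simp: differentiable_def)
  qed
  note Q(1)[simp]
  have [measurable]: "Measurable.pred borel (\<lambda>s. g differentiable (at s))"
    unfolding diff by measurable
  have [measurable]: "(\<lambda>s. det (A s)) \<in> borel_measurable borel"
    unfolding det_def A_def by simp
  have "(\<lambda>s. if g differentiable (at s) then det (jacobian g (at s)) else 0) =
      (\<lambda>s. if g differentiable (at s) then det (A s) else 0)"
    by (auto simp: jac)
  also have "\<dots> \<in> borel_measurable borel"
    by measurable
  finally show ?thesis .
qed

text \<open>The Leibniz expansion has d! terms, each a signed product of d entries.\<close>

lemma abs_det_le:
  fixes A :: "real ^ 'd ^ 'd"
  assumes "\<And>i j. \<bar>A $ i $ j\<bar> \<le> C"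
  shows "\<bar>det A\<bar> \<le> fact CARD('d) * C ^ CARD('d)"
proof -
  have "\<bar>det A\<bar> \<le> (\<Sum>p | p permutes (UNIV :: 'd set). \<bar>of_int (sign p) * (\<Prod>i\<in>UNIV. A $ i $ p i)\<bar>)"
    unfolding det_def by (rule sum_abs)
  also have "\<dots> \<le> (\<Sum>p | p permutes (UNIV :: 'd set). C ^ CARD('d))"
  proof (rule sum_mono)
    fix p :: "'d \<Rightarrow> 'd"
    have "(\<Prod>i\<in>UNIV. \<bar>A $ i $ p i\<bar>) \<le> (\<Prod>i\<in>(UNIV :: 'd set). C)"
      using assms by (intro prod_mono) auto
    then show "\<bar>of_int (sign p) * (\<Prod>i\<in>UNIV. A $ i $ p i)\<bar> \<le> C ^ CARD('d)"
      by (simp add: abs_mult abs_prod sign_def)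
  qed
  also have "\<dots> = fact CARD('d) * C ^ CARD('d)"
    by (simp add: card_permutations[OF refl])
  finally show ?thesis .
qed

text \<open>The difference quotients at \<open>s\<close> are eventually at most \<open>C\<close> in
  absolute value, hence so are their limits, the entries of the Jacobian matrix.\<close>

lemma det_jacobian_bound:
  fixes g :: "real ^ 'd \<Rightarrow> real ^ 'd"
  assumes diff: "g differentiable (at s)" and S: "open S" "s \<in> S"
    and lip: "\<And>y i. y \<in> S \<Longrightarrow> \<bar>g y $ i - g s $ i\<bar> \<le> C * norm (y - s)"
  shows "\<bar>det (jacobian g (at s))\<bar> \<le> fact CARD('d) * C ^ CARD('d)"
proof (rule abs_det_le)
  fix i j
  let ?y = "\<lambda>k. s + inverse (real (Suc k)) *\<^sub>R axis j 1"
  have "?y \<longlonglongrightarrow> s + 0 *\<^sub>R axis j 1"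
    by (intro tendsto_intros LIMSEQ_inverse_real_of_nat)
  then have "\<forall>\<^sub>F k in sequentially. ?y k \<in> S"
    using S by (intro topological_tendstoD) auto
  then have "\<forall>\<^sub>F k in sequentially. \<bar>(g (?y k) $ i - g s $ i) * real (Suc k)\<bar> \<le> C"
  proof eventually_elim
    case (elim k)
    then show ?case
      using lip[OF elim, of i] by (simp add: abs_mult divide_simps)
  qed
  then show "\<bar>jacobian g (at s) $ i $ j\<bar> \<le> C"
    by (intro tendsto_upperbound[OF tendsto_rabs[OF jacobian_entry_tendsto[OF diff]]]) auto
qed

section \<open>Uniqueness in the moment problem on a compact set\<close>

text \<open>The vanishing of the integrals against \<open>h\<close> passes from monomials to
  polynomials, then by Stone-Weierstrass to continuous functions, and by dominated convergence to
  indicators of closed sets. Inner regularity then excludes that \<open>h\<close> is positive, or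
  negative, on a set of positive measure.\<close>

lemma AE_zero_if_moments_zero:
  fixes h :: "real ^ 'd \<Rightarrow> real" and S :: "(real ^ 'd) set"
  assumes S: "compact S" and h: "set_integrable lborel S h"
    and zero: "\<And>s. s \<notin> S \<Longrightarrow> h s = 0"
    and moments: "\<And>a. (LINT s|lborel. h s * (\<Prod>j\<in>UNIV. s $ j ^ a j)) = 0"
  shows "AE s in lborel. h s = 0"
proof -
  have int_h: "integrable lborel h"
  proof -
    have "(\<lambda>s. indicat_real S s *\<^sub>R h s) = h"
      using zero by (auto simp: fun_eq_iff indicator_def)
    then show ?thesis using h by (simp add: set_integrable_def)
  qed
  then have [measurable]: "h \<in> borel_measurable borel" by (simp add: borel_measurable_integrable flip: measurable_lborel1)
  have int_cont: "integrable lborel (\<lambda>s. h s * p s)" if p: "continuous_on UNIV p" for p :: "real ^ 'd \<Rightarrow> real"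
  proof -
    have [measurable]: "p \<in> borel_measurable borel"
      using p by (rule borel_measurable_continuous_onI)
    obtain B where B: "\<And>s. s \<in> S \<Longrightarrow> norm (p s) \<le> B"
      using compact_imp_bounded[OF compact_continuous_image[OF continuous_on_subset[OF p subset_UNIV] S]]
      by (auto simp: bounded_iff)
    show ?thesis
    proof (rule Bochner_Integration.integrable_bound)
      show "integrable lborel (\<lambda>s. B * h s)" using int_h by simp
      have "norm (h s * p s) \<le> norm (B * h s)" for s
      proof (cases "s \<in> S")
        case True
        then have "\<bar>p s\<bar> \<le> \<bar>B\<bar>" using B[of s] by simp
        then show ?thesis by (metis abs_ge_zero abs_mult mult.commute mult_left_mono real_norm_def)
      qed (simp add: zero)
      then show "AE s in lborel. norm (h s * p s) \<le> norm (B * h s)" by simp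
    qed measurable
  qed
  \<comment> \<open>Test functions are required to be annihilated together with all their multiples
    by monomials. This makes \<open>G\<close> stable under multiplication by coordinates, and so by
    polynomials.\<close>
  define G where "G = {p. continuous_on UNIV p \<and> (\<forall>a. (LINT s|lborel. h s * ((\<Prod>j\<in>UNIV. s $ j ^ a j) * p s)) = 0)}"
  have mono_cont: "continuous_on UNIV (\<lambda>s::real^'d. \<Prod>j\<in>UNIV. s $ j ^ a j)" for a :: "'d \<Rightarrow> nat"
    by (intro continuous_intros)
  have G_cont: "p \<in> G \<Longrightarrow> continuous_on UNIV p" for p by (simp add: G_def)
  have G_int: "integrable lborel (\<lambda>s. h s * ((\<Prod>j\<in>UNIV. s $ j ^ a j) * p s))" if "p \<in> G" for a p
    by (intro int_cont continuous_on_mult mono_cont G_cont that)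
  have G_one: "(\<lambda>_. 1) \<in> G" using moments by (simp add: G_def)
  have G_add: "(\<lambda>s. p s + q s) \<in> G" if "p \<in> G" "q \<in> G" for p q
    using that G_int[OF that(1)] G_int[OF that(2)]
    by (auto simp: G_def distrib_left intro!: continuous_on_add)
  have G_scale: "(\<lambda>s. c * p s) \<in> G" if "p \<in> G" for p c
  proof -
    have "(LINT s|lborel. h s * ((\<Prod>j\<in>UNIV. s $ j ^ a j) * (c * p s))) =
        (LINT s|lborel. c * (h s * ((\<Prod>j\<in>UNIV. s $ j ^ a j) * p s)))" for a
      by (simp only: mult_ac)
    then show ?thesis using that by (auto simp: G_def intro!: continuous_on_mult)
  qed
  have G_coord: "(\<lambda>s. s $ i * p s) \<in> G" if "p \<in> G" for p i
  proof -
    have "(LINT s|lborel. h s * ((\<Prod>j\<in>UNIV. s $ j ^ a j) * (s $ i * p s))) = 0" for a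
    proof -
      \<comment> \<open>The extra coordinate is absorbed into the monomial by raising its
        exponent.\<close>
      have "(\<Prod>j\<in>UNIV. s $ j ^ a j) * s $ i = (\<Prod>j\<in>UNIV. s $ j ^ (a(i := Suc (a i))) j)" for s :: "real ^ 'd"
        by (simp add: prod.remove[of UNIV i] mult_ac)
      then have eq: "(\<Prod>j\<in>UNIV. s $ j ^ a j) * (s $ i * p s) = (\<Prod>j\<in>UNIV. s $ j ^ (a(i := Suc (a i))) j) * p s" for s
        by (metis mult.assoc)
      show ?thesis
        unfolding eq using that by (simp add: G_def del: fun_upd_apply)
    qed
    then show ?thesis using that by (auto simp: G_def intro!: continuous_intros)
  qed
  have G_sum: "(\<lambda>s. \<Sum>i\<in>I. f i s) \<in> G" if "finite I" "\<And>i. i \<in> I \<Longrightarrow> f i \<in> G" for I :: "'d set" and f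
    using that
  proof (induction I rule: finite_induct)
    case empty
    then show ?case using G_scale[OF G_one, of 0] by simp
  next
    case (insert i I)
    then show ?case using G_add[of "f i" "\<lambda>s. \<Sum>i\<in>I. f i s"] by simp
  qed
  \<comment> \<open>The polynomial acts as a multiplier on an arbitrary element of \<open>G\<close>,
    so that the case of a product is the composition of two induction hypotheses.\<close>
  have poly_G: "(\<lambda>s. q s * p s) \<in> G" if "real_polynomial_function q" "p \<in> G" for q p
    using that
  proof (induction arbitrary: p rule: real_polynomial_function.induct)
    case (linear f)
    have "f s * p s = (\<Sum>i\<in>UNIV. f (axis i 1) * (s $ i * p s))" for s
    proof -
      have "f s = f (\<Sum>i\<in>UNIV. (s $ i) *\<^sub>R axis i 1)"
        using basis_expansion[of s] by (simp add: scalar_mult_eq_scaleR)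
      also have "\<dots> = (\<Sum>i\<in>UNIV. s $ i * f (axis i 1))"
        using linear(1) by (simp add: linear_sum bounded_linear.linear linear_cmul)
      finally show ?thesis by (simp add: sum_distrib_left mult_ac)
    qed
    then show ?case
      using linear by (simp add: G_sum G_scale G_coord)
  next
    case (const c)
    then show ?case by (rule G_scale)
  next
    case (add f g)
    then show ?case by (simp add: distrib_right G_add)
  next
    case (mult f g)
    then show ?case using mult(3)[OF mult(4)[OF mult.prems]] by (simp add: mult.assoc)
  qed
  have cont_zero: "(LINT s|lborel. h s * p s) = 0" if p: "continuous_on UNIV p" for p :: "real ^ 'd \<Rightarrow> real"
  proof -
    let ?c = "LINT s|lborel. \<bar>h s\<bar>"
    have bound: "\<bar>LINT s|lborel. h s * p s\<bar> \<le> \<epsilon> * ?c" if "\<epsilon> > 0" for \<epsilon>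
    proof -
      obtain q where q: "real_polynomial_function q" "\<And>s. s \<in> S \<Longrightarrow> \<bar>p s - q s\<bar> < \<epsilon>"
        using Stone_Weierstrass_real_polynomial_function[OF S continuous_on_subset[OF p subset_UNIV] \<open>\<epsilon> > 0\<close>] by auto
      have "q \<in> G" using poly_G[OF q(1) G_one] by simp
      \<comment> \<open>Membership in \<open>G\<close> is used at the exponent 0, where the monomial
        is 1.\<close>
      then have q0: "(LINT s|lborel. h s * q s) = 0" and cq: "continuous_on UNIV q"
        unfolding G_def by (auto dest!: spec[of _ "\<lambda>_. 0"])
      have ii: "integrable lborel (\<lambda>s. h s * (p s - q s))"
        by (intro int_cont continuous_on_diff p cq)
      have "(LINT s|lborel. h s * p s) = (LINT s|lborel. h s * (p s - q s))"
        using q0 int_cont[OF p] int_cont[OF cq] by (simp add: right_diff_distrib)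
      also have "\<bar>\<dots>\<bar> \<le> (LINT s|lborel. \<bar>h s * (p s - q s)\<bar>)"
        by (rule integral_abs_bound)
      also have "\<dots> \<le> (LINT s|lborel. \<epsilon> * \<bar>h s\<bar>)"
      proof (rule integral_mono)
        show "integrable lborel (\<lambda>s. \<bar>h s * (p s - q s)\<bar>)" using ii by (rule integrable_abs)
        show "integrable lborel (\<lambda>s. \<epsilon> * \<bar>h s\<bar>)" using int_h by simp
        show "\<bar>h s * (p s - q s)\<bar> \<le> \<epsilon> * \<bar>h s\<bar>" for s
          using q(2)[of s] zero[of s]
          by (cases "s \<in> S") (auto simp: abs_mult mult.commute[of \<epsilon>] intro!: mult_left_mono)
      qed
      finally show ?thesis by simp
    qed
    have "\<bar>LINT s|lborel. h s * p s\<bar> \<le> 0 + \<delta>" if "\<delta> > 0" for \<delta>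
    proof -
      have c: "?c \<ge> 0" by simp
      \<comment> \<open>The summand 1 keeps the denominator positive when \<open>h\<close> has
        integral norm 0.\<close>
      have "\<bar>LINT s|lborel. h s * p s\<bar> \<le> \<delta> / (?c + 1) * ?c"
        using c that by (intro bound divide_pos_pos) linarith+
      also have "\<dots> \<le> \<delta>"
      proof -
        have "0 < ?c + 1" using c by linarith
        then show ?thesis using that by (simp add: divide_le_eq distrib_left)
      qed
      finally show ?thesis by simp
    qed
    then have "\<bar>LINT s|lborel. h s * p s\<bar> \<le> 0" by (rule field_le_epsilon)
    then show ?thesis by simp
  qed
  have closed_zero: "(LINT s:T|lborel. h s) = 0" if T: "closed T" for T
  \<comment> \<open>\<open>infdist\<close> to the empty set is 0, so the approximation below
    converges to the indicator of \<open>T\<close> only for nonempty \<open>T\<close>.\<close>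
  proof (cases "T = {}")
    case False
    \<comment> \<open>Continuous functions equal to 1 on \<open>T\<close> that decrease to its
      indicator, because a point outside the closed set \<open>T\<close> has positive distance from
      it.\<close>
    define \<phi> where "\<phi> k s = max 0 (1 - real k * infdist s T)" for k s
    have c: "continuous_on UNIV (\<phi> k)" for k
      unfolding \<phi>_def by (intro continuous_intros)
    have "(\<lambda>k. LINT s|lborel. h s * \<phi> k s) \<longlonglongrightarrow> (LINT s|lborel. indicat_real T s *\<^sub>R h s)"
    proof (rule integral_dominated_convergence)
      show "integrable lborel (\<lambda>s. \<bar>h s\<bar>)" using int_h by simp
      have "(\<lambda>k. h s * \<phi> k s) \<longlonglongrightarrow> indicat_real T s *\<^sub>R h s" for s
      proof (cases "s \<in> T")
        case True
        then show ?thesis by (simp add: \<phi>_def)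
      next
        case nT: False
        then have pos: "infdist s T > 0"
          using T False infdist_pos_not_in_closed by blast
        obtain N where N: "real N * infdist s T > 1"
          using reals_Archimedean3[OF pos] by blast
        have "h s * \<phi> k s = 0" if "k \<ge> N" for k
        proof -
          have "real N * infdist s T \<le> real k * infdist s T" using that pos by (intro mult_right_mono) auto
          then show ?thesis using N by (simp add: \<phi>_def)
        qed
        then show ?thesis using nT
          by (intro tendsto_eventually) (auto simp: eventually_sequentially)
      qed
      then show "AE s in lborel. (\<lambda>k. h s * \<phi> k s) \<longlonglongrightarrow> indicat_real T s *\<^sub>R h s" by simp
      show "AE s in lborel. norm (h s * \<phi> k s) \<le> \<bar>h s\<bar>" for k
        by (intro AE_I2) (auto simp: \<phi>_def abs_mult infdist_nonneg max_def intro!: mult_left_le)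
      show "(\<lambda>s. h s * \<phi> k s) \<in> borel_measurable lborel" for k
        using int_cont[OF c] by (rule borel_measurable_integrable)
      show "(\<lambda>s. indicat_real T s *\<^sub>R h s) \<in> borel_measurable lborel"
        using T by (auto intro!: borel_measurable_scaleR borel_measurable_indicator)
    qed
    then show ?thesis
      using cont_zero[OF c] by (simp add: set_lebesgue_integral_def LIMSEQ_const_iff)
  qed (simp add: set_lebesgue_integral_def)
  \<comment> \<open>The sign \<open>\<sigma>\<close> treats the sets where \<open>h\<close> is
    positive and where it is negative at once.\<close>
  have null: "{s. \<sigma> * h s > 0} \<in> null_sets lborel" if \<sigma>: "\<sigma> \<in> {1, -1}" for \<sigma> :: real
  proof -
    let ?A = "{s. \<sigma> * h s > 0}"
    have A: "?A \<in> sets lborel" by measurable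
    have small: "emeasure lborel ?A \<le> 0 + ennreal \<epsilon>" if "\<epsilon> > 0" for \<epsilon>
    proof -
      \<comment> \<open>On a closed \<open>T\<close> inside \<open>?A\<close> the integrand is
        positive but integrates to 0, so \<open>T\<close> is null. What remains of \<open>?A\<close>
        has measure below \<open>\<epsilon>\<close>.\<close>
      obtain T where T: "closed T" "T \<subseteq> ?A" "?A - T \<in> lmeasurable" "emeasure lebesgue (?A - T) < ennreal \<epsilon>"
        by (rule sets_lebesgue_inner_closed[OF sets_completionI_sets[OF A] \<open>\<epsilon> > 0\<close>])
      have Tm: "T \<in> sets lborel" using T(1) by simp
      have "(LINT s:T|lborel. \<sigma> * h s) = 0" using closed_zero[OF T(1)] by (simp add: set_integral_mult_right)
      moreover have "integrable lborel (\<lambda>s. indicat_real T s *\<^sub>R (\<sigma> * h s))"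
        using int_h Tm by (intro integrable_mult_indicator) auto
      ultimately have "AE s in lborel. indicat_real T s *\<^sub>R (\<sigma> * h s) = 0"
        unfolding set_lebesgue_integral_def
        by (subst (asm) integral_nonneg_eq_0_iff_AE) (use T(2) in \<open>auto simp: indicator_def less_imp_le subset_iff\<close>)
      then have "AE s in lborel. s \<notin> T"
        by eventually_elim (use T(2) in \<open>auto simp: indicator_def split: if_splits\<close>)
      then have "T \<in> null_sets lborel" using Tm by (simp add: AE_iff_null_sets)
      have "?A = (?A - T) \<union> T" using T(2) by auto
      then have "emeasure lborel ?A = emeasure lborel (?A - T)"
        using \<open>T \<in> null_sets lborel\<close> A Tm by (metis emeasure_Un_null_set sets.Diff)
      then show ?thesis using T(4) A Tm by simp
    qed
    have "emeasure lborel ?A \<le> 0" by (rule ennreal_le_epsilon) (rule small)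
    then show ?thesis using A by (simp add: null_sets_def)
  qed
  have "AE s in lborel. s \<notin> {s. 1 * h s > 0}" "AE s in lborel. s \<notin> {s. -1 * h s > 0}"
    by (intro AE_not_in null; simp)+
  then show ?thesis by eventually_elim auto
qed

section \<open>Products of simplices\<close>

lemma product_sigma_finite_lborel: "product_sigma_finite (\<lambda>_::nat. lborel :: (real ^ 'd) measure)"
  by standard

abbreviation multi_lborel :: "nat \<Rightarrow> (nat \<Rightarrow> real ^ 'd::finite) measure" where
  "multi_lborel m \<equiv> PiM {1..m} (\<lambda>_. lborel)"

text \<open>The consecutive inequalities chain together, and a strictly increasing map between
  linear orders also reflects the order. Thus the order of the points in coordinate \<open>j\<close>
  depends on \<open>\<pi> j\<close> alone.\<close>

lemma D_less_iff:
  assumes "t \<in> D m \<pi>" "k \<in> {1..m}" "l \<in> {1..m}"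
  shows "t (\<pi> j k) $ j < t (\<pi> j l) $ j \<longleftrightarrow> k < l"
proof -
  have mono: "t (\<pi> j k) $ j < t (\<pi> j l) $ j" if "k \<in> {1..m}" "l \<in> {1..m}" "k < l" for k l
  proof -
    have "Suc k \<le> l" using that by simp
    then show ?thesis using that(2)
    proof (induction rule: dec_induct)
      case base
      then show ?case using assms(1) that by (auto simp: D_def)
    next
      case (step i)
      then have "t (\<pi> j i) $ j < t (\<pi> j (Suc i)) $ j"
        using assms(1) that by (auto simp: D_def)
      then show ?case using step by auto
    qed
  qed
  then show ?thesis
    using assms(2,3) by (metis linorder_less_linear order_less_asym order_less_irrefl)
qed

text \<open>Ranks recover the permutation from the point: the indices whose points lie at or below
  the k-th one are exactly \<open>\<pi> j\<close> followed by the positions up to \<open>k\<close>,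
  that is, the image of \<open>{1..k}\<close>.\<close>

lemma D_rank:
  assumes "t \<in> D m \<pi>" "\<pi> j permutes {1..m}" "k \<in> {1..m}"
  shows "card {i \<in> {1..m}. t i $ j \<le> t (\<pi> j k) $ j} = k"
proof -
  have "{i \<in> {1..m}. t i $ j \<le> t (\<pi> j k) $ j} = \<pi> j ` {1..k}"
  proof (intro set_eqI iffI)
    fix i assume i: "i \<in> {i \<in> {1..m}. t i $ j \<le> t (\<pi> j k) $ j}"
    then obtain l where "l \<in> {1..m}" "i = \<pi> j l"
      using permutes_image[OF assms(2)] by blast
    then show "i \<in> \<pi> j ` {1..k}"
      using i D_less_iff[OF assms(1,3), of l j] by force
  next
    fix i assume "i \<in> \<pi> j ` {1..k}"
    then obtain l where l: "l \<in> {1..k}" "i = \<pi> j l" by auto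
    then show "i \<in> {i \<in> {1..m}. t i $ j \<le> t (\<pi> j k) $ j}"
      using D_less_iff[OF assms(1,3), of l j] assms(3) permutes_in_image[OF assms(2), of l] by auto
  qed
  then show ?thesis
    by (simp add: card_image permutes_inj_on[OF assms(2)])
qed

text \<open>An index of the form \<open>\<pi> j k = \<rho> j l\<close> has rank \<open>k\<close> by
  the first membership and rank \<open>l\<close> by the second. Outside \<open>{1..m}\<close> both
  permutations are the identity.\<close>

lemma D_disjoint:
  assumes t: "t \<in> D m \<pi>" "t \<in> D m \<rho>"
    and perm: "\<And>j. \<pi> j permutes {1..m}" "\<And>j. \<rho> j permutes {1..m}"
  shows "\<pi> = \<rho>"
proof (intro ext)
  fix j k
  show "\<pi> j k = \<rho> j k"
  proof (cases "k \<in> {1..m}")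
    case True
    then have "\<pi> j k \<in> {1..m}" using permutes_in_image[OF perm(1)] by blast
    then obtain l where l: "l \<in> {1..m}" "\<pi> j k = \<rho> j l"
      using permutes_image[OF perm(2), of j] by blast
    then have "k = l"
      using D_rank[OF t(1) perm(1) True] D_rank[OF t(2) perm(2) l(1)] by metis
    then show ?thesis using l by simp
  next
    case False
    then show ?thesis using perm by (metis permutes_not_in)
  qed
qed

text \<open>\<open>D\<close> bounds only the least and the greatest value in each coordinate; the
  others lie between them.\<close>

lemma D_subset_cube:
  assumes "\<And>j. \<pi> j permutes {1..m}"
  shows "D m \<pi> \<subseteq> {1..m} \<rightarrow>\<^sub>E cube"
proof
  fix t assume t: "t \<in> D m \<pi>"
  have "0 \<le> t i $ j \<and> t i $ j \<le> 1" if "i \<in> {1..m}" for i j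
  proof -
    have "i \<in> \<pi> j ` {1..m}"
      using that by (simp only: permutes_image[OF assms])
    then obtain k where k: "k \<in> {1..m}" "i = \<pi> j k" by blast
    have "1 \<in> {1..m}" "m \<in> {1..m}" using that by auto
    from D_less_iff[OF t k(1) this(1), of j] D_less_iff[OF t this(2) k(1), of j]
    have "t (\<pi> j 1) $ j \<le> t i $ j" "t i $ j \<le> t (\<pi> j m) $ j"
      using k by (simp_all add: not_less[symmetric] del: not_less)
    moreover have "0 \<le> t (\<pi> j 1) $ j" "t (\<pi> j m) $ j \<le> 1"
      using t by (simp_all add: D_def)
    ultimately show ?thesis by linarith
  qed
  then show "t \<in> {1..m} \<rightarrow>\<^sub>E cube"
    using t by (auto simp: D_def cube_def mem_box_cart)
qed

text \<open>Sorting: when no two points share a coordinate, ranking the points in coordinate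
  \<open>j\<close> is a permutation, and its inverse lists them in increasing order.\<close>

lemma D_exists:
  assumes t: "t \<in> {1..m} \<rightarrow>\<^sub>E cube" and m: "1 \<le> m" and inj: "\<And>j. inj_on (\<lambda>i. t i $ j) {1..m}"
  shows "\<exists>\<pi>. (\<forall>j. \<pi> j permutes {1..m}) \<and> t \<in> D m \<pi>"
proof -
  \<comment> \<open>The rank of point \<open>i\<close> in coordinate \<open>j\<close>, extended by
    the identity as \<open>permutes\<close> demands.\<close>
  define r where "r j i = (if i \<in> {1..m} then card {l \<in> {1..m}. t l $ j \<le> t i $ j} else i)" for j i
  have r_less: "r j i < r j l" if "i \<in> {1..m}" "l \<in> {1..m}" "t i $ j < t l $ j" for i j l
  proof -
    define A where "A i = {k \<in> {1..m}. t k $ j \<le> t i $ j}" for i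
    have "finite (A l)" "l \<notin> A i" "l \<in> A l" "A i \<subseteq> A l"
      using that by (auto simp: A_def)
    then have "card (A i) < card (A l)"
      by (metis psubsetI psubset_card_mono)
    then show ?thesis using that by (simp add: r_def A_def)
  qed
  have perm: "r j permutes {1..m}" for j
  proof (rule bij_imp_permutes)
    have "inj_on (r j) {1..m}"
    proof (rule inj_onI)
      fix i l assume il: "i \<in> {1..m}" "l \<in> {1..m}" "r j i = r j l"
      then have "t i $ j = t l $ j" using r_less by (metis linorder_neq_iff)
      then show "i = l" using inj_onD[OF inj _ il(1,2), of j] by simp
    qed
    moreover have "r j ` {1..m} \<subseteq> {1..m}"
    proof
      fix k assume "k \<in> r j ` {1..m}"
      then obtain i where i: "i \<in> {1..m}" "k = card {l \<in> {1..m}. t l $ j \<le> t i $ j}" by (auto simp: r_def)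
      then have "k \<noteq> 0" by auto
      moreover have "k \<le> card {1..m}" unfolding i by (intro card_mono) auto
      ultimately show "k \<in> {1..m}" by auto
    qed
    ultimately show "bij_betw (r j) {1..m} {1..m}"
      by (simp add: bij_betw_def endo_inj_surj)
  qed (simp only: r_def if_False)
  \<comment> \<open>\<open>r j\<close> sends an index to its position, whereas \<open>D\<close>
    expects the map from positions to indices.\<close>
  define \<pi> where "\<pi> j = inv (r j)" for j
  have \<pi>: "\<pi> j permutes {1..m}" for j unfolding \<pi>_def by (rule permutes_inv[OF perm])
  have "t (\<pi> j k) $ j < t (\<pi> j (Suc k)) $ j" if "k \<in> {1..<m}" for j k
  proof (rule ccontr)
    assume c: "\<not> t (\<pi> j k) $ j < t (\<pi> j (Suc k)) $ j"
    have in1: "\<pi> j k \<in> {1..m}" "\<pi> j (Suc k) \<in> {1..m}"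
      using that by (simp_all only: permutes_in_image[OF \<pi>]) auto
    have r: "r j (\<pi> j i) = i" for i by (simp add: \<pi>_def permutes_inverses[OF perm])
    have "t (\<pi> j (Suc k)) $ j \<noteq> t (\<pi> j k) $ j"
      using inj_onD[OF inj _ in1, of j] r by (metis n_not_Suc_n)
    then show False using r_less[OF in1(2,1), of j] c by (simp add: r)
  qed
  moreover have "t i $ j \<in> {0..1}" if "i \<in> {1..m}" for i j
    using PiE_mem[OF t that] by (simp add: cube_def mem_box_cart)
  moreover have "\<pi> j 1 \<in> {1..m}" "\<pi> j m \<in> {1..m}" for j
    using m by (simp_all only: permutes_in_image[OF \<pi>]) auto
  ultimately have "t \<in> D m \<pi>"
    using t by (auto simp: D_def)
  then show ?thesis using \<pi> by blast
qed

section \<open>Measurability and volume of the sets D\<close>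

lemma sets_D:
  assumes "\<And>j. \<pi> j permutes {1..m}" "1 \<le> m"
  shows "D m \<pi> \<in> sets (multi_lborel m)"
proof -
  have coord [measurable]: "(\<lambda>t. t (\<pi> j k) $ j) \<in> borel_measurable (multi_lborel m)" if "k \<in> {1..m}" for j k
  proof -
    have "\<pi> j k \<in> {1..m}" using that permutes_in_image[OF assms(1)] by blast
    then have "(\<lambda>t. t (\<pi> j k)) \<in> borel_measurable (multi_lborel m)"
      using measurable_component_singleton[of "\<pi> j k" "{1..m}" "\<lambda>_. lborel"] by simp
    then show ?thesis
      by (rule measurable_compose) (simp add: borel_measurable_continuous_onI continuous_intros)
  qed
  have m: "1 \<in> {1..m}" "m \<in> {1..m}" using assms(2) by auto
  have [measurable]: "Measurable.pred (multi_lborel m) (\<lambda>t. t (\<pi> j k) $ j < t (\<pi> j (Suc k)) $ j)"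
    if "k \<in> {1..<m}" for j k
  proof -
    have [measurable]: "(\<lambda>t. t (\<pi> j k) $ j) \<in> borel_measurable (multi_lborel m)"
        "(\<lambda>t. t (\<pi> j (Suc k)) $ j) \<in> borel_measurable (multi_lborel m)"
      using that by (auto intro!: coord)
    show ?thesis by measurable
  qed
  have "{t \<in> space (multi_lborel m). \<forall>j.
     0 \<le> t (\<pi> j 1) $ j \<and> (\<forall>k\<in>{1..<m}. t (\<pi> j k) $ j < t (\<pi> j (Suc k)) $ j) \<and> t (\<pi> j m) $ j \<le> 1}
    \<in> sets (multi_lborel m)"
    using m by measurable
  then show ?thesis by (simp add: D_def space_PiM)
qed

text \<open>A product measure is determined by its values on boxes. The preimage of a box is the box
  with its sides rearranged by \<open>inv \<sigma>\<close>, and the product of the side measures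
  does not see the order.\<close>

lemma distr_permute:
  assumes "\<sigma> permutes {1..m}"
  shows "distr (multi_lborel m) (multi_lborel m) (\<lambda>t. \<lambda>i\<in>{1..m}. t (\<sigma> i)) = (multi_lborel m :: (nat \<Rightarrow> real ^ 'd) measure)"
proof -
  interpret product_sigma_finite "\<lambda>_::nat. lborel :: (real ^ 'd) measure" by (rule product_sigma_finite_lborel)
  let ?T = "\<lambda>t :: nat \<Rightarrow> real ^ 'd. \<lambda>i\<in>{1..m}. t (\<sigma> i)"
  have in_iff: "\<sigma> i \<in> {1..m} \<longleftrightarrow> i \<in> {1..m}" for i by (rule permutes_in_image[OF assms])
  have T: "?T \<in> measurable (multi_lborel m) (multi_lborel m)"
    using in_iff by (intro measurable_restrict measurable_component_singleton) auto
  show ?thesis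
  proof (rule PiM_eqI)
    fix A :: "nat \<Rightarrow> (real ^ 'd) set"
    assume A: "\<And>i. i \<in> {1..m} \<Longrightarrow> A i \<in> sets lborel"
    have inv: "inv \<sigma> i \<in> {1..m} \<longleftrightarrow> i \<in> {1..m}" for i
      by (rule permutes_in_image[OF permutes_inv[OF assms]])
    have "(\<forall>i\<in>{1..m}. t (\<sigma> i) \<in> A i) \<longleftrightarrow> (\<forall>i\<in>{1..m}. t i \<in> A (inv \<sigma> i))" for t
    proof -
      have "(\<forall>i\<in>{1..m}. t i \<in> A (inv \<sigma> i)) \<longleftrightarrow> (\<forall>i\<in>\<sigma> ` {1..m}. t i \<in> A (inv \<sigma> i))"
        by (simp only: permutes_image[OF assms])
      then show ?thesis by (simp add: permutes_inverses[OF assms])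
    qed
    then have "?T -` Pi\<^sub>E {1..m} A \<inter> space (multi_lborel m) = (\<Pi>\<^sub>E i\<in>{1..m}. A (inv \<sigma> i))"
      by (intro set_eqI) (simp add: space_PiM PiE_iff)
    then have "emeasure (distr (multi_lborel m) (multi_lborel m) ?T) (Pi\<^sub>E {1..m} A) = emeasure (multi_lborel m) (\<Pi>\<^sub>E i\<in>{1..m}. A (inv \<sigma> i))"
      using A by (subst emeasure_distr[OF T]) (auto intro: sets_PiM_I_finite)
    also have "\<dots> = (\<Prod>i\<in>{1..m}. emeasure lborel (A (inv \<sigma> i)))"
      using A inv by (intro emeasure_PiM) auto
    also have "\<dots> = (\<Prod>i\<in>{1..m}. emeasure lborel (A i))"
      using prod.permute[OF permutes_inv[OF assms], of "\<lambda>i. emeasure lborel (A i)"] by (simp add: o_def)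
    finally show "emeasure (distr (multi_lborel m) (multi_lborel m) ?T) (Pi\<^sub>E {1..m} A) = (\<Prod>i\<in>{1..m}. emeasure lborel (A i))" .
  qed auto
qed

lemma emeasure_multi_cube: "emeasure (multi_lborel m) ({1..m} \<rightarrow>\<^sub>E (cube :: (real ^ 'd) set)) = 1"
proof -
  interpret product_sigma_finite "\<lambda>_::nat. lborel :: (real ^ 'd) measure" by (rule product_sigma_finite_lborel)
  have "emeasure lborel (cube :: (real ^ 'd) set) = 1"
    unfolding cube_def by (subst emeasure_lborel_cbox_eq) (auto simp: Basis_vec_def inner_axis intro!: prod.neutral)
  then show ?thesis
    by (subst emeasure_PiM) (auto simp: cube_def)
qed

abbreviation multi_perms :: "nat \<Rightarrow> ('d::finite \<Rightarrow> nat \<Rightarrow> nat) set" where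
  "multi_perms m \<equiv> {\<pi>. \<forall>j. \<pi> j permutes {1..m}}"

lemma finite_multi_perms: "finite (multi_perms m :: ('d::finite \<Rightarrow> nat \<Rightarrow> nat) set)"
proof -
  have "finite (PiE (UNIV :: 'd set) (\<lambda>_. {p. p permutes {1..m}}))"
    by (intro finite_PiE) (auto intro: finite_permutations)
  then show ?thesis by (simp add: PiE_UNIV_domain Pi_def)
qed

lemma sum_measure_D_le:
  fixes \<P> :: "('d::finite \<Rightarrow> nat \<Rightarrow> nat) set"
  assumes "1 \<le> m" and \<P>: "\<P> \<subseteq> multi_perms m"
  shows "(\<Sum>\<pi>\<in>\<P>. measure (multi_lborel m) (D m \<pi>)) \<le> 1"
proof -
  have fin: "finite \<P>" using finite_multi_perms \<P> by (rule rev_finite_subset)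
  let ?C = "{1..m} \<rightarrow>\<^sub>E (cube :: (real ^ 'd) set)"
  have sub: "D m \<pi> \<subseteq> ?C" "D m \<pi> \<in> sets (multi_lborel m)" if "\<pi> \<in> \<P>" for \<pi>
    using that \<P> assms(1) by (blast intro!: sets_D D_subset_cube)+
  have C: "?C \<in> sets (multi_lborel m)" by (intro sets_PiM_I_finite) (auto simp: cube_def)
  have "emeasure (multi_lborel m) (D m \<pi>) \<noteq> \<infinity>" if "\<pi> \<in> \<P>" for \<pi>
    using emeasure_mono[OF sub(1)[OF that] C] emeasure_multi_cube[where 'd='d] by (auto simp: top_unique)
  moreover have "disjoint_family_on (D m) \<P>"
    using D_disjoint \<P> by (fastforce simp: disjoint_family_on_def)
  ultimately have "(\<Sum>\<pi>\<in>\<P>. measure (multi_lborel m) (D m \<pi>)) = measure (multi_lborel m) (\<Union>\<pi>\<in>\<P>. D m \<pi>)"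
    using fin sub by (intro measure_finite_Union[symmetric]) auto
  also have "\<dots> \<le> measure (multi_lborel m) ?C"
    using sub C fin emeasure_multi_cube[where 'd='d and m=m]
    by (intro measure_mono_fmeasurable fmeasurableI) auto
  also have "\<dots> = 1" by (simp add: measure_def emeasure_multi_cube)
  finally show ?thesis .
qed

lemma measure_D_le:
  fixes \<pi> :: "'d::finite \<Rightarrow> nat \<Rightarrow> nat"
  assumes m: "1 \<le> m" and \<pi>: "\<pi> \<in> multi_perms m"
  shows "measure (multi_lborel m) (D m \<pi>) \<le> 1 / fact m"
proof -
  let ?S = "{\<sigma>. \<sigma> permutes {1..m}}"
  \<comment> \<open>Renaming the points by \<open>\<sigma>\<close> changes all the permutations
    \<open>\<pi> j\<close> simultaneously, by composition on the left.\<close>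
  let ?c = "\<lambda>\<sigma>. (\<lambda>j. \<sigma> \<circ> \<pi> j)"
  have inj: "inj_on ?c ?S"
  proof (rule inj_onI)
    fix \<sigma> \<tau> assume "?c \<sigma> = ?c \<tau>"
    then have "\<sigma> \<circ> \<pi> j = \<tau> \<circ> \<pi> j" for j by metis
    moreover have "surj (\<pi> j)" for j using \<pi> permutes_surj by blast
    ultimately show "\<sigma> = \<tau>" by (metis fun.map_comp surj_fun_eq)
  qed
  have eq: "measure (multi_lborel m) (D m (?c \<sigma>)) = measure (multi_lborel m) (D m \<pi>)" if \<sigma>: "\<sigma> permutes {1..m}" for \<sigma>
  proof -
    let ?T = "\<lambda>t :: nat \<Rightarrow> real ^ 'd. \<lambda>i\<in>{1..m}. t (\<sigma> i)"
    have in_iff: "\<sigma> i \<in> {1..m} \<longleftrightarrow> i \<in> {1..m}" for i by (rule permutes_in_image[OF \<sigma>])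
    have T: "?T \<in> measurable (multi_lborel m) (multi_lborel m)"
      using in_iff by (intro measurable_restrict measurable_component_singleton) auto
    have pin: "\<pi> j i \<in> {1..m}" if "i \<in> {1..m}" for i j using \<pi> that by (metis mem_Collect_eq permutes_in_image)
    \<comment> \<open>The renamed tuple satisfies the inequalities of \<open>\<pi>\<close> exactly
      when the original one satisfies those of \<open>?c \<sigma>\<close>. As \<open>\<pi> j\<close>
      keeps positions inside \<open>{1..m}\<close>, the restriction in \<open>?T\<close> has no
      effect there.\<close>
    have "?T -` D m \<pi> \<inter> space (multi_lborel m) = D m (?c \<sigma>)"
      using pin m by (auto simp: D_def space_PiM)
    then have "measure (distr (multi_lborel m) (multi_lborel m) ?T) (D m \<pi>) = measure (multi_lborel m) (D m (?c \<sigma>))"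
      using \<pi> m by (subst measure_distr[OF T]) (auto intro!: sets_D)
    then show ?thesis by (simp add: distr_permute[OF \<sigma>])
  qed
  have "fact m * measure (multi_lborel m) (D m \<pi>) = (\<Sum>\<sigma>\<in>?S. measure (multi_lborel m) (D m (?c \<sigma>)))"
    by (simp add: eq card_permutations[of "{1..m}" m])
  also have "\<dots> = (\<Sum>\<rho>\<in>?c ` ?S. measure (multi_lborel m) (D m \<rho>))"
    by (simp add: sum.reindex[OF inj])
  also have "\<dots> \<le> 1"
    using \<pi> by (intro sum_measure_D_le m) (auto intro: permutes_compose)
  finally show ?thesis by (simp add: field_simps)
qed

section \<open>Null sets, and integrals over unions of order types\<close>

lemma AE_multi_component:
  assumes "AE s in (lborel :: (real ^ 'd) measure). Q s"
  shows "AE t in multi_lborel m. \<forall>i\<in>{1..m}. Q (t i)"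
proof (rule AE_finite_allI)
  interpret product_sigma_finite "\<lambda>_::nat. lborel :: (real ^ 'd) measure" by (rule product_sigma_finite_lborel)
  fix i assume i: "i \<in> {1..m}"
  obtain N where N: "{s \<in> space lborel. \<not> Q s} \<subseteq> N" "emeasure lborel N = 0" "N \<in> sets lborel"
    using AE_E[OF assms] .
  \<comment> \<open>The exceptional tuples lie in a box with one null side, whose product measure is
    0 even though other sides are infinite.\<close>
  let ?N = "PiE {1..m} (\<lambda>k. if k = i then N else UNIV)"
  have "emeasure (multi_lborel m) ?N = 0"
    using N i by (subst emeasure_PiM) auto
  moreover have "?N \<in> sets (multi_lborel m)"
    using N by (intro sets_PiM_I_finite) auto
  ultimately have "?N \<in> null_sets (multi_lborel m)" by auto
  moreover have "{t \<in> space (multi_lborel m). \<not> Q (t i)} \<subseteq> ?N"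
    using N(1) by (auto simp: space_PiM PiE_iff extensional_def)
  ultimately show "AE t in multi_lborel m. Q (t i)" by (rule AE_I')
qed simp

text \<open>With all points but \<open>t i\<close> fixed, a coincidence in coordinate
  \<open>j\<close> confines \<open>t i\<close> to a hyperplane, so by Fubini coincidences form a
  null set. Together with \<open>D_exists\<close>, almost every tuple in the cube has an order
  type.\<close>

lemma AE_multi_inj: "AE t in (multi_lborel m :: (nat \<Rightarrow> real ^ 'd) measure). \<forall>j. inj_on (\<lambda>i. t i $ j) {1..m}"
proof -
  interpret product_sigma_finite "\<lambda>_::nat. lborel :: (real ^ 'd) measure" by (rule product_sigma_finite_lborel)
  have "AE t in multi_lborel m. t i $ j \<noteq> t l $ (j :: 'd)" if il: "i \<in> {1..m}" "l \<in> {1..m}" "i \<noteq> l" for i l j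
  proof -
    let ?I = "{1..m} - {i}"
    let ?N = "{t \<in> space (multi_lborel m). t i $ j = t l $ j}"
    have eqI: "{1..m} = insert i ?I" using il by auto
    have meas [measurable]: "(\<lambda>t. t k $ j) \<in> borel_measurable (multi_lborel m)" if "k \<in> {1..m}" for k
    proof -
      have "(\<lambda>t. t k) \<in> borel_measurable (multi_lborel m)"
        using measurable_component_singleton[of k "{1..m}" "\<lambda>_. lborel"] that by simp
      then show ?thesis
        by (rule measurable_compose) (simp add: borel_measurable_continuous_onI continuous_intros)
    qed
    have N: "?N \<in> sets (multi_lborel m)"
      using il by measurable
    have hyp: "emeasure lborel {y :: real ^ 'd. y $ j = c} = 0" for c
    proof -
      have "negligible {y :: real ^ 'd. y $ j = c}"
        using negligible_standard_hyperplane[of "axis j 1 :: real ^ 'd" c] by (simp add: inner_axis)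
      moreover have "{y :: real ^ 'd. y $ j = c} \<in> sets lborel"
        by (simp add: closed_Collect_eq continuous_intros)
      ultimately show ?thesis
        by (simp add: negligible_iff_emeasure0)
    qed
    have "emeasure (multi_lborel m) ?N = (\<integral>\<^sup>+t. indicator ?N t \<partial>multi_lborel m)"
      using N by simp
    also have "\<dots> = (\<integral>\<^sup>+x. \<integral>\<^sup>+y. indicator ?N (x(i := y)) \<partial>lborel \<partial>PiM ?I (\<lambda>_. lborel))"
      using product_nn_integral_insert[of ?I i "indicator ?N"] N unfolding eqI[symmetric] by simp
    also have "\<dots> = (\<integral>\<^sup>+x. 0 \<partial>PiM ?I (\<lambda>_. lborel :: (real ^ 'd) measure))"
    proof (rule nn_integral_cong)
      fix x assume x: "x \<in> space (PiM ?I (\<lambda>_. lborel :: (real ^ 'd) measure))"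
      have "x(i := y) \<in> space (multi_lborel m)" for y
        using x il by (auto simp: space_PiM PiE_iff extensional_def)
      then have "indicator ?N (x(i := y)) = (indicator {y. y $ j = x l $ j} y :: ennreal)" for y
        using il by (auto simp: indicator_def)
      then show "(\<integral>\<^sup>+y. indicator ?N (x(i := y)) \<partial>lborel) = 0"
        by (simp add: hyp closed_Collect_eq continuous_intros)
    qed
    finally have "?N \<in> null_sets (multi_lborel m)" using N by auto
    then show ?thesis by (rule AE_I') auto
  qed
  then have "AE t in multi_lborel m. \<forall>i\<in>{1..m}. \<forall>l\<in>{1..m}. \<forall>j::'d\<in>UNIV. i \<noteq> l \<longrightarrow> t i $ j \<noteq> t l $ j"
    by (intro AE_finite_allI) auto
  then show ?thesis
    by eventually_elim (auto simp: inj_on_def)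
qed

text \<open>By \<open>order\<close>, \<open>E\<close> contains every \<open>D m \<pi>\<close> that
  it meets. These sets are disjoint and cover almost all of \<open>E\<close>, so the integral splits
  into a finite sum.\<close>

lemma integral_order_type:
  fixes f :: "(nat \<Rightarrow> real ^ 'd::finite) \<Rightarrow> real"
  assumes m: "1 \<le> m" and f: "integrable (multi_lborel m) f"
    and E: "E \<subseteq> {1..m} \<rightarrow>\<^sub>E cube"
    and order: "\<And>t u \<pi>. \<pi> \<in> multi_perms m \<Longrightarrow> t \<in> D m \<pi> \<Longrightarrow> u \<in> D m \<pi> \<Longrightarrow> t \<in> E \<Longrightarrow> u \<in> E"
    and E_sets: "E \<in> sets (multi_lborel m)"
  shows "(LINT t:E|multi_lborel m. f t) =
    (\<Sum>\<pi> | \<pi> \<in> multi_perms m \<and> D m \<pi> \<subseteq> E. (LINT t:D m \<pi>|multi_lborel m. f t))"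
proof -
  let ?\<P> = "{\<pi>. \<pi> \<in> multi_perms m \<and> D m \<pi> \<subseteq> E}"
  have fin: "finite ?\<P>" using finite_multi_perms by (rule rev_finite_subset) auto
  have "AE t in multi_lborel m. indicator E t *\<^sub>R f t = (\<Sum>\<pi>\<in>?\<P>. indicator (D m \<pi>) t *\<^sub>R f t)"
    using AE_multi_inj
  proof eventually_elim
    case (elim t)
    show ?case
    proof (cases "t \<in> E")
      case True
      then obtain \<pi> where \<pi>: "\<pi> \<in> multi_perms m" "t \<in> D m \<pi>"
        using D_exists[of t m] E m elim by auto
      then have "\<pi> \<in> ?\<P>" using order True by auto
      \<comment> \<open>By disjointness only the order type of \<open>t\<close> itself
        contributes.\<close>
      have "indicator (D m \<rho>) t *\<^sub>R f t = (if \<rho> = \<pi> then f t else 0)" if "\<rho> \<in> ?\<P>" for \<rho>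
      proof -
        have "t \<in> D m \<rho> \<longleftrightarrow> \<rho> = \<pi>"
          using D_disjoint[of t m \<pi> \<rho>] \<pi> that by blast
        then show ?thesis by (simp add: indicator_def)
      qed
      then have "(\<Sum>\<rho>\<in>?\<P>. indicator (D m \<rho>) t *\<^sub>R f t) = f t"
        using fin \<open>\<pi> \<in> ?\<P>\<close> by (simp add: sum.delta)
      then show ?thesis using True by simp
    next
      case False
      then have "(\<Sum>\<rho>\<in>?\<P>. indicator (D m \<rho>) t *\<^sub>R f t) = 0"
        by (intro sum.neutral) (auto simp: indicator_def)
      then show ?thesis using False by simp
    qed
  qed
  moreover have meas: "D m \<pi> \<in> sets (multi_lborel m)" if "\<pi> \<in> ?\<P>" for \<pi>
    using that m by (auto intro: sets_D)
  have intg: "integrable (multi_lborel m) (\<lambda>t. indicat_real (D m \<pi>) t *\<^sub>R f t)" if "\<pi> \<in> ?\<P>" for \<pi>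
    using f meas[OF that] by (intro integrable_mult_indicator)
  ultimately have "(LINT t:E|multi_lborel m. f t) = (LINT t|multi_lborel m. (\<Sum>\<pi>\<in>?\<P>. indicator (D m \<pi>) t *\<^sub>R f t))"
    unfolding set_lebesgue_integral_def using f E_sets meas
    by (intro integral_cong_AE borel_measurable_integrable integrable_mult_indicator Bochner_Integration.integrable_sum)
  also have "\<dots> = (\<Sum>\<pi>\<in>?\<P>. (LINT t:D m \<pi>|multi_lborel m. f t))"
    unfolding set_lebesgue_integral_def using intg by (intro Bochner_Integration.integral_sum)
  finally show ?thesis .
qed

section \<open>Minors and the signature\<close>

text \<open>Measurability of \<open>f\<close> is a conclusion here: in a complete measure it follows
  from almost everywhere equality with \<open>g\<close>. This allows the integrand of the signature
  to be replaced by a Borel one.\<close>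

lemma integral_completion_cong_AE:
  fixes f g :: "'a \<Rightarrow> real"
  assumes g: "g \<in> borel_measurable M" and eq: "AE x in M. f x = g x"
  shows "integral\<^sup>L (completion M) f = integral\<^sup>L M g"
proof -
  have g': "g \<in> borel_measurable (completion M)" using g by (rule measurable_completion)
  have "f \<in> borel_measurable (completion M)"
  proof (rule measurableI)
    fix A :: "real set" assume A: "A \<in> sets borel"
    have [measurable]: "Measurable.pred (completion M) (\<lambda>x. f x \<noteq> g x \<and> f x \<in> A)"
        "Measurable.pred (completion M) (\<lambda>x. f x \<noteq> g x \<and> f x \<notin> A)"
      using eq by (auto intro!: sets_completion_AE)
    have [measurable]: "Measurable.pred (completion M) (\<lambda>x. g x \<in> A)"
      using g' A by measurable
    \<comment> \<open>The preimage under \<open>f\<close> is that under \<open>g\<close>, corrected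
      by two subsets of the null set where \<open>f\<close> and \<open>g\<close> differ.\<close>
    have "(\<lambda>x. f x \<in> A) =
        (\<lambda>x. (g x \<in> A \<and> \<not> (f x \<noteq> g x \<and> f x \<notin> A)) \<or> (f x \<noteq> g x \<and> f x \<in> A))"
      by auto
    then have "Measurable.pred (completion M) (\<lambda>x. f x \<in> A)" by (simp only:) measurable
    then show "f -` A \<inter> space (completion M) \<in> sets (completion M)"
      by (simp add: pred_def vimage_def Int_def conj_commute)
  qed simp
  then have "integral\<^sup>L (completion M) f = integral\<^sup>L (completion M) g"
    using g' eq by (intro integral_cong_AE AE_completion)
  then show ?thesis using g by (simp add: integral_completion)
qed

lemma AE_cube_iff_box: "AE s in lborel. s \<in> cube \<longleftrightarrow> s \<in> box 0 (1 :: real ^ 'd)"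
proof -
  have "negligible (cbox 0 1 - box 0 1 :: (real ^ 'd) set)"
    by (rule negligible_frontier_interval)
  then have "cbox 0 1 - box 0 1 \<in> null_sets (lborel :: (real ^ 'd) measure)"
    by (subst null_sets_completion_iff[symmetric]) (auto simp: negligible_iff_null_sets)
  then have "AE s in lborel. s \<notin> cbox 0 1 - box 0 (1 :: real ^ 'd)"
    by (rule AE_not_in)
  then show ?thesis
    by eventually_elim (use box_subset_cbox in \<open>auto simp: cube_def\<close>)
qed

text \<open>
  Restricted to the open cube, the minors involve no one-sided derivatives and are Borel functions.
\<close>

definition minor :: "(nat \<Rightarrow> 'v::real_inner) \<Rightarrow> (real ^ 'd::finite \<Rightarrow> 'v) \<Rightarrow> ('d \<Rightarrow> 'd + nat) \<Rightarrow> real ^ 'd \<Rightarrow> real" where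
  "minor e x I s = (if s \<in> box 0 1 then J (bar_basis e) (\<lambda>s. (s, x s)) I s else 0)"

lemma at_within_cube: "s \<in> box 0 1 \<Longrightarrow> at s within cube = at s"
  unfolding cube_def by (rule at_within_interior) (simp only: interior_cbox)

text \<open>The \<open>Inl\<close> coordinates of \<open>(s, x s)\<close> are \<open>s\<close>
  itself, so the Jacobian matrix is the identity.\<close>

lemma minor_Inl:
  fixes x :: "real ^ 'd \<Rightarrow> 'v::real_inner"
  shows "minor e x Inl = indicator (box 0 1)"
proof
  fix s :: "real ^ 'd"
  have "(\<chi> i. (t, x t) \<bullet> bar_basis e (Inl i)) = t" for t :: "real ^ 'd"
    by (simp add: bar_basis_def inner_axis vec_eq_iff)
  moreover have "jacobian (\<lambda>t. t) (at s) = mat 1"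
    by (simp add: jacobian_def frechet_derivative_ident matrix_id_mat_1[unfolded id_def])
  ultimately show "minor e x Inl s = indicator (box 0 1) s"
    by (simp add: minor_def J_def at_within_cube)
qed

lemma minor_Inr:
  fixes x :: "real ^ 'd \<Rightarrow> 'v::real_inner"
  shows "s \<in> box 0 1 \<Longrightarrow> minor e x (Inr \<circ> P) s = J e x P s"
  by (simp add: minor_def J_def bar_basis_def)

lemma minor_outside: "s \<notin> box 0 1 \<Longrightarrow> minor e x I s = 0"
  by (simp add: minor_def)

lemma ord_inj_in_range: "P \<in> ord_inj n \<Longrightarrow> P i \<in> {1..n}"
  by (rule subsetD[of "range P"]) (simp_all add: ord_inj_def)

text \<open>On the open cube the selected coordinates of \<open>x\<close> agree with a continuous
  function on the whole space, and derivatives there depend only on nearby values. The general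
  measurability and bound for Jacobian determinants therefore apply.\<close>

lemma minor_regular:
  fixes x :: "real ^ 'd::{finite,linorder} \<Rightarrow> 'v::real_inner"
  assumes C: "C-lipschitz_on cube x" and e: "\<And>k. k \<in> {1..n} \<Longrightarrow> norm (e k) = 1" and P: "P \<in> ord_inj n"
  shows "minor e x (Inr \<circ> P) \<in> borel_measurable borel"
    and "\<bar>minor e x (Inr \<circ> P) s\<bar> \<le> fact CARD('d) * C ^ CARD('d)"
proof -
  have C0: "C \<ge> 0" using C by (rule lipschitz_on_nonneg)
  define f where "f s = (\<chi> i. x s \<bullet> e (P i) :: (real, 'd) vec)" for s
  \<comment> \<open>Composition with the projection onto the cube extends \<open>f\<close>
    continuously from the closed cube.\<close>
  define g where "g s = f (clamp 0 1 s)" for s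
  \<comment> \<open>Cauchy-Schwarz against unit vectors: each coordinate inherits the Lipschitz
    constant.\<close>
  have f_lip: "\<bar>f y $ i - f s $ i\<bar> \<le> C * norm (y - s)" if "y \<in> cube" "s \<in> cube" for y s i
  proof -
    have "f y $ i - f s $ i = (x y - x s) \<bullet> e (P i)"
      by (simp add: f_def inner_diff_left)
    also have "\<bar>\<dots>\<bar> \<le> norm (x y - x s) * norm (e (P i))"
      by (rule Cauchy_Schwarz_ineq2)
    also have "norm (e (P i)) = 1" using P by (intro e ord_inj_in_range)
    finally show ?thesis
      using lipschitz_onD[OF C that] by (simp add: dist_norm)
  qed
  have "continuous_on cube x" using C by (rule lipschitz_on_continuous_on)
  then have "continuous_on (cbox 0 1) f"
    unfolding f_def cube_def by (intro continuous_intros)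
  then have g_cont: "continuous_on UNIV g"
    unfolding g_def by (rule clamp_continuous_on)
  have fg: "f t = g t" if "t \<in> box 0 1" for t
    using that box_subset_cbox[of 0 "1 :: (real, 'd) vec"] by (auto simp: g_def)
  have "(f has_derivative f') (at s) \<longleftrightarrow> (g has_derivative f') (at s)" if "s \<in> box 0 1" for s f'
    using has_derivative_transform_within_open[OF _ open_box that] fg by metis
  then have minor_eq: "minor e x (Inr \<circ> P) s =
      (if s \<in> box 0 1 then if g differentiable (at s) then det (jacobian g (at s)) else 0 else 0)" for s
    by (simp add: minor_def J_def bar_basis_def at_within_cube f_def[symmetric] differentiable_def
        jacobian_def frechet_derivative_def)
  have [measurable]: "(\<lambda>s. if g differentiable (at s) then det (jacobian g (at s)) else 0) \<in> borel_measurable borel"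
    using g_cont by (rule borel_measurable_det_jacobian)
  show "minor e x (Inr \<circ> P) \<in> borel_measurable borel"
    unfolding minor_eq[abs_def] by measurable
  show "\<bar>minor e x (Inr \<circ> P) s\<bar> \<le> fact CARD('d) * C ^ CARD('d)"
  proof (cases "s \<in> box 0 1 \<and> g differentiable (at s)")
    case True
    have "\<bar>det (jacobian g (at s))\<bar> \<le> fact CARD('d) * C ^ CARD('d)"
    proof (rule det_jacobian_bound[OF _ open_box])
      show "\<bar>g y $ i - g s $ i\<bar> \<le> C * norm (y - s)" if "y \<in> box 0 1" for y i
        using f_lip[of y s i] fg that True box_subset_cbox[of 0 "1 :: (real, 'd) vec"] by (auto simp: cube_def)
    qed (use True in auto)
    then show ?thesis using True by (simp add: minor_eq)
  next
    case False
    then have "minor e x (Inr \<circ> P) s = 0"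
      unfolding minor_eq by argo
    then show ?thesis using C0 by simp
  qed
qed

section \<open>The signature with respect to a fixed orthonormal basis\<close>

context
  fixes n :: nat and e :: "nat \<Rightarrow> 'v::real_inner"
  assumes basis: "orthonormal_basis n e"
begin

lemma norm_basis: "k \<in> {1..n} \<Longrightarrow> norm (e k) = 1"
  using basis by (simp add: orthonormal_basis_def norm_eq_1)

lemma minor_measurable:
  fixes x :: "real ^ 'd::{finite,linorder} \<Rightarrow> 'v"
  assumes "x \<in> Lip" "I \<in> W n"
  shows "minor e x I \<in> borel_measurable borel"
proof -
  obtain C where C: "C-lipschitz_on cube x" using assms(1) by (auto simp: Lip_def)
  consider "I = Inl" | Q where "Q \<in> ord_inj n" "I = Inr \<circ> Q"
    using assms(2) unfolding W_def by blast
  then show ?thesis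
  proof cases
    case 2
    then show ?thesis using minor_regular(1)[OF C norm_basis 2(1)] by simp
  qed (simp add: minor_Inl)
qed

lemma minor_bounded:
  fixes x :: "real ^ 'd::{finite,linorder} \<Rightarrow> 'v"
  assumes "x \<in> Lip"
  obtains L where "L \<ge> 0" "\<And>I s. I \<in> W n \<Longrightarrow> \<bar>minor e x I s\<bar> \<le> L"
proof -
  obtain C where C: "C-lipschitz_on cube x" using assms by (auto simp: Lip_def)
  \<comment> \<open>The 1 covers the minor of \<open>Inl\<close>, the second entry all minors
    indexed by \<open>ord_inj n\<close>, so one bound serves every index in
    \<open>W n\<close>.\<close>
  let ?L = "max 1 (fact CARD('d) * C ^ CARD('d))"
  have "\<bar>minor e x I s\<bar> \<le> ?L" if "I \<in> W n" for I s
    using that minor_regular(2)[OF C norm_basis, where s = s] unfolding W_def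
    by (auto simp: minor_Inl indicator_def intro: order_trans[OF _ max.cobounded2])
  then show ?thesis by (intro that[of ?L]) auto
qed

lemma minor_integrable:
  fixes x :: "real ^ 'd::{finite,linorder} \<Rightarrow> 'v"
  assumes "x \<in> Lip" "I \<in> W n"
  shows "integrable lborel (minor e x I)"
proof -
  obtain L where L: "L \<ge> 0" "\<And>I s. I \<in> W n \<Longrightarrow> \<bar>minor e x I s\<bar> \<le> L"
    using minor_bounded[OF assms(1)] by metis
  have "integrable lborel (indicat_real (box 0 (1 :: (real, 'd) vec)))"
    by (intro integrable_real_indicator) (use emeasure_bounded_finite[OF bounded_box] in auto)
  then have "integrable lborel (\<lambda>s. L * indicat_real (box 0 (1 :: (real, 'd) vec)) s)"
    by (rule integrable_mult_right)
  then show ?thesis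
  proof (rule Bochner_Integration.integrable_bound)
    show "minor e x I \<in> borel_measurable lborel" using minor_measurable[OF assms] by simp
    show "AE s in lborel. norm (minor e x I s) \<le> norm (L * indicat_real (box 0 1) s)"
    proof (intro AE_I2)
      fix s
      show "norm (minor e x I s) \<le> norm (L * indicat_real (box 0 1) s)"
        using L(1) L(2)[OF assms(2), of s] by (cases "s \<in> box 0 1") (auto simp: minor_def)
    qed
  qed
qed

lemma integrable_prod_minor:
  fixes x :: "real ^ 'd::{finite,linorder} \<Rightarrow> 'v"
  assumes "x \<in> Lip" "\<And>i. i \<in> {1..m} \<Longrightarrow> P i \<in> W n"
  shows "integrable (multi_lborel m) (\<lambda>t. \<Prod>i\<in>{1..m}. minor e x (P i) (t i))"
proof -
  interpret product_sigma_finite "\<lambda>_::nat. lborel :: ((real, 'd) vec) measure" by (rule product_sigma_finite_lborel)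
  show ?thesis
    by (intro product_integrable_prod minor_integrable assms) simp_all
qed

text \<open>Brings the coordinates into a form to which Fubini applies. Tuples in
  \<open>D m \<pi>\<close> have their points in the closed cube, hence almost surely in the open
  cube, where \<open>J\<close> and \<open>minor\<close> coincide.\<close>

lemma signature_eq:
  fixes x :: "real ^ 'd::{finite,linorder} \<Rightarrow> 'v"
  assumes "x \<in> Lip" "(P, \<pi>) \<in> coords n m" "1 \<le> m" and W: "\<And>i. i \<in> {1..m} \<Longrightarrow> P i \<in> W n"
  shows "signature n e x m (P, \<pi>) = (LINT t:D m \<pi>|multi_lborel m. (\<Prod>i\<in>{1..m}. minor e x (P i) (t i)))"
proof -
  have \<pi>: "\<pi> j permutes {1..m}" for j using assms(2) by (auto simp: coords_def)
  let ?p = "\<lambda>t. \<Prod>i\<in>{1..m}. J (bar_basis e) (\<lambda>s. (s, x s)) (P i) (t i)"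
  let ?q = "\<lambda>t. \<Prod>i\<in>{1..m}. minor e x (P i) (t i)"
  have "signature n e x m (P, \<pi>) = (LINT t:D m \<pi>|completion (multi_lborel m). ?p t)"
    using assms(2,3) W by (auto simp: signature_def)
  also have "\<dots> = (LINT t:D m \<pi>|multi_lborel m. ?q t)"
    unfolding set_lebesgue_integral_def
  proof (rule integral_completion_cong_AE)
    show "(\<lambda>t. indicat_real (D m \<pi>) t *\<^sub>R ?q t) \<in> borel_measurable (multi_lborel m)"
      using sets_D[OF \<pi> assms(3)] integrable_prod_minor[OF assms(1) W]
      by (intro borel_measurable_integrable integrable_mult_indicator)
    show "AE t in multi_lborel m. indicat_real (D m \<pi>) t *\<^sub>R ?p t = indicat_real (D m \<pi>) t *\<^sub>R ?q t"
      using AE_multi_component[OF AE_cube_iff_box, of m]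
    proof eventually_elim
      case (elim t)
      show ?case
      proof (cases "t \<in> D m \<pi>")
        case True
        then have "t \<in> {1..m} \<rightarrow>\<^sub>E cube"
          using D_subset_cube[OF \<pi>] by (rule subsetD[rotated])
        then have "t i \<in> cube" if "i \<in> {1..m}" for i
          using that by (rule PiE_mem)
        then have "t i \<in> box 0 1" if "i \<in> {1..m}" for i
          using elim that by simp
        then show ?thesis by (simp add: minor_def)
      qed simp
    qed
  qed
  finally show ?thesis .
qed

section \<open>Passage to Jacobian equivalence classes\<close>

text \<open>The boundary of the cube is null, and the index \<open>Inl\<close> may be included
  because its minor is the same for all maps.\<close>

lemma jacobian_equiv_iff_minor:
  fixes x y :: "real ^ 'd::{finite,linorder} \<Rightarrow> 'v"
  shows "(x, y) \<in> jacobian_equiv n e \<longleftrightarrow> x \<in> Lip \<and> y \<in> Lip \<and>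
    (\<forall>I\<in>W n. AE s in lborel. minor e x I s = minor e y I s)"
proof -
  have "(AE s in lebesgue_on cube. J e x P s = J e y P s) \<longleftrightarrow>
      (AE s in lborel. minor e x (Inr \<circ> P) s = minor e y (Inr \<circ> P) s)" for P
  proof -
    have "(AE s in lebesgue_on cube. J e x P s = J e y P s) \<longleftrightarrow>
        (AE s in lborel. s \<in> cube \<longrightarrow> J e x P s = J e y P s)"
    proof -
      have "cube \<inter> space lebesgue \<in> sets (lebesgue :: (real, 'd) vec measure)"
        by (simp add: cube_def)
      then show ?thesis by (simp only: AE_restrict_space_iff AE_completion_iff)
    qed
    also have "\<dots> \<longleftrightarrow> (AE s in lborel. minor e x (Inr \<circ> P) s = minor e y (Inr \<circ> P) s)"
    proof
      assume "AE s in lborel. s \<in> cube \<longrightarrow> J e x P s = J e y P s"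
      then show "AE s in lborel. minor e x (Inr \<circ> P) s = minor e y (Inr \<circ> P) s"
        using AE_cube_iff_box by eventually_elim (metis minor_Inr minor_outside)
    next
      assume "AE s in lborel. minor e x (Inr \<circ> P) s = minor e y (Inr \<circ> P) s"
      then show "AE s in lborel. s \<in> cube \<longrightarrow> J e x P s = J e y P s"
        using AE_cube_iff_box by eventually_elim (metis minor_Inr)
    qed
    finally show ?thesis .
  qed
  then show ?thesis
    by (auto simp: jacobian_equiv_def W_def minor_Inl)
qed

lemma equiv_jacobian_equiv:
  "equiv Lip (jacobian_equiv n e :: (real ^ 'd::{finite,linorder} \<Rightarrow> 'v) rel)"
proof (rule equivI)
  show "trans (jacobian_equiv n e :: ((real, 'd) vec \<Rightarrow> 'v) rel)"
  proof (rule transI)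
    fix x y z :: "(real, 'd) vec \<Rightarrow> 'v"
    assume xy: "(x, y) \<in> jacobian_equiv n e" and yz: "(y, z) \<in> jacobian_equiv n e"
    have "AE s in lborel. minor e x I s = minor e z I s" if "I \<in> W n" for I
    proof -
      have "AE s in lborel. minor e x I s = minor e y I s" "AE s in lborel. minor e y I s = minor e z I s"
        using xy yz that by (auto simp: jacobian_equiv_iff_minor)
      then show ?thesis by eventually_elim simp
    qed
    then show "(x, z) \<in> jacobian_equiv n e" using xy yz by (simp add: jacobian_equiv_iff_minor)
  qed
qed (auto simp: refl_on_def sym_def jacobian_equiv_iff_minor eq_commute)

text \<open>This makes the signature well defined on classes: almost surely, all \<open>m\<close>
  factors of the two integrands agree simultaneously.\<close>

lemma signature_cong:
  fixes x y :: "real ^ 'd::{finite,linorder} \<Rightarrow> 'v"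
  assumes "(x, y) \<in> jacobian_equiv n e"
  shows "signature n e x = signature n e y"
proof (intro ext)
  fix m and k :: "'d coord"
  obtain P \<pi> where k: "k = (P, \<pi>)" by force
  have Lip: "x \<in> Lip" "y \<in> Lip" using assms by (auto simp: jacobian_equiv_iff_minor)
  show "signature n e x m k = signature n e y m k"
  proof (cases "k \<in> coords n m \<and> 1 \<le> m \<and> (\<forall>i\<in>{1..m}. P i \<in> W n)")
    case True
    then have c: "(P, \<pi>) \<in> coords n m" "1 \<le> m" and W: "\<And>i. i \<in> {1..m} \<Longrightarrow> P i \<in> W n"
      by (auto simp: k)
    have \<pi>: "\<pi> j permutes {1..m}" for j using c by (auto simp: coords_def)
    have "AE t in multi_lborel m. \<forall>i\<in>{1..m}. minor e x (P i) (t i) = minor e y (P i) (t i)"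
    proof (rule AE_finite_allI)
      fix i assume i: "i \<in> {1..m}"
      then have "AE s in lborel. minor e x (P i) s = minor e y (P i) s"
        using assms W by (auto simp: jacobian_equiv_iff_minor)
      from AE_multi_component[OF this, of m]
      show "AE t in multi_lborel m. minor e x (P i) (t i) = minor e y (P i) (t i)"
        by eventually_elim (use i in auto)
    qed simp
    then have "AE t in multi_lborel m. indicat_real (D m \<pi>) t *\<^sub>R (\<Prod>i\<in>{1..m}. minor e x (P i) (t i)) =
        indicat_real (D m \<pi>) t *\<^sub>R (\<Prod>i\<in>{1..m}. minor e y (P i) (t i))"
      by eventually_elim simp
    then have "(LINT t:D m \<pi>|multi_lborel m. (\<Prod>i\<in>{1..m}. minor e x (P i) (t i))) =
        (LINT t:D m \<pi>|multi_lborel m. (\<Prod>i\<in>{1..m}. minor e y (P i) (t i)))"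
      unfolding set_lebesgue_integral_def
      by (intro integral_cong_AE borel_measurable_integrable integrable_mult_indicator
          sets_D[OF \<pi> c(2)] integrable_prod_minor Lip W)
    then show ?thesis
      using signature_eq[OF Lip(1) c W] signature_eq[OF Lip(2) c W] by (simp add: k)
  next
    \<comment> \<open>The remaining values are \<open>undefined\<close>, 1 or 0, whatever the
      map.\<close>
    case False
    then show ?thesis by (auto simp: k signature_def restrict_def)
  qed
qed

lemma signature_J_class:
  fixes x :: "real ^ 'd::{finite,linorder} \<Rightarrow> 'v"
  assumes "x \<in> Lip"
  shows "signature_J n e (jacobian_equiv n e `` {x}) = signature n e x"
proof -
  have "x \<in> jacobian_equiv n e `` {x}"
    using assms by (auto simp: jacobian_equiv_iff_minor)
  then have nonempty: "jacobian_equiv n e `` {x} \<noteq> {}"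
    by (metis empty_iff)
  have "signature n e y = signature n e x" if "y \<in> jacobian_equiv n e `` {x}" for y
    using signature_cong[of x y] that by simp
  then show ?thesis
    unfolding signature_J_def by (rule the_elem_image_unique[OF nonempty])
qed

section \<open>Moments of a minor as sums of signature coordinates\<close>

text \<open>Fix the first point \<open>s\<close>, which carries \<open>I\<close>. Every other point
  carries the minor 1 and contributes the volume of its region. In coordinate \<open>j\<close> the
  points 2 to \<open>Suc (a j)\<close> must stay below \<open>s\<close>, giving \<open>a j\<close>
  factors \<open>s $ j\<close>, while the later ones are free and give 1. The length
  \<open>m\<close> is large enough for every \<open>j\<close>, and \<open>E\<close> is, up to a null
  set, a union of order types.\<close>

lemma signature_moment:
  fixes x :: "real ^ 'd::{finite,linorder} \<Rightarrow> 'v" and a :: "'d \<Rightarrow> nat"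
  assumes x: "x \<in> Lip" and I: "I \<in> W n"
  defines "m \<equiv> Suc (\<Sum>j\<in>UNIV. a j)"
  defines "P \<equiv> \<lambda>i\<in>{1..m}. if i = 1 then I else Inl"
  defines "E \<equiv> {t \<in> {1..m} \<rightarrow>\<^sub>E cube. \<forall>j. \<forall>i\<in>{2..Suc (a j)}. t i $ j < t 1 $ j}"
  shows "(LINT s|lborel. minor e x I s * (\<Prod>j\<in>UNIV. s $ j ^ a j)) =
    (\<Sum>\<pi> | \<pi> \<in> multi_perms m \<and> D m \<pi> \<subseteq> E. signature n e x m (P, \<pi>))"
proof -
  interpret product_sigma_finite "\<lambda>_::nat. lborel :: (real, 'd) vec measure" by (rule product_sigma_finite_lborel)
  have m: "1 \<le> m" by (simp add: m_def)
  have a_less: "Suc (a j) \<le> m" for j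
    unfolding m_def using member_le_sum[of j UNIV a] by simp
  have P_W: "P i \<in> W n" if "i \<in> {1..m}" for i
    using that I by (auto simp: P_def W_def)
  \<comment> \<open>\<open>signature\<close> is restricted to \<open>coords\<close>, so the word
    \<open>P\<close> has to consist of increasing form indices.\<close>
  have "Inr \<circ> Q \<in> form_indices n" if "Q \<in> ord_inj n" for Q :: "'d \<Rightarrow> nat"
    using that ord_inj_in_range[OF that]
    by (auto simp: form_indices_def ord_inj_def monotone_on_def strict_mono_def)
  moreover have "(Inl :: 'd \<Rightarrow> _) \<in> form_indices n"
    by (auto simp: form_indices_def monotone_on_def)
  ultimately have "W n \<subseteq> (form_indices n :: ('d \<Rightarrow> 'd + nat) set)"
    by (auto simp: W_def)
  then have coords: "(P, \<pi>) \<in> coords n m" if "\<pi> \<in> multi_perms m" for \<pi>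
    using that P_W by (auto simp: coords_def P_def)
  let ?f = "\<lambda>t. \<Prod>i\<in>{1..m}. minor e x (P i) (t i)"
  have f_int: "integrable (multi_lborel m) ?f"
    by (rule integrable_prod_minor[OF x P_W])
  have comp [measurable]: "(\<lambda>t. t i $ j) \<in> borel_measurable (multi_lborel m)" if "i \<in> {1..m}" for i j
  proof -
    have "(\<lambda>t. t i) \<in> borel_measurable (multi_lborel m)"
      using measurable_component_singleton[OF that, of "\<lambda>_. lborel"] by simp
    then show ?thesis
      by (rule measurable_compose) (simp add: borel_measurable_continuous_onI continuous_intros)
  qed
  have E_sets: "E \<in> sets (multi_lborel m)"
  proof -
    have cube: "{1..m} \<rightarrow>\<^sub>E cube \<in> sets (multi_lborel m)"
      by (intro sets_PiM_I_finite) (auto simp: cube_def)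
    have "{t \<in> space (multi_lborel m). t i $ j < t 1 $ j} \<in> sets (multi_lborel m)"
      if "i \<in> {2..Suc (a j)}" for i j
    proof -
      have "i \<in> {1..m}" "1 \<in> {1..m}" using that a_less[of j] by auto
      then show ?thesis by (intro borel_measurable_less comp)
    qed
    then have "{t \<in> space (multi_lborel m). \<forall>j\<in>UNIV. \<forall>i\<in>{2..Suc (a j)}. t i $ j < t 1 $ j} \<in> sets (multi_lborel m)"
      by (intro sets.sets_Collect_finite_All) auto
    with cube have "({1..m} \<rightarrow>\<^sub>E cube) \<inter> {t \<in> space (multi_lborel m). \<forall>j\<in>UNIV. \<forall>i\<in>{2..Suc (a j)}. t i $ j < t 1 $ j} \<in> sets (multi_lborel m)"
      by (rule sets.Int)
    also have "({1..m} \<rightarrow>\<^sub>E cube) \<inter> {t \<in> space (multi_lborel m). \<forall>j\<in>UNIV. \<forall>i\<in>{2..Suc (a j)}. t i $ j < t 1 $ j} = E"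
      by (auto simp: E_def space_PiM)
    finally show ?thesis .
  qed
  \<comment> \<open>Whether point \<open>i\<close> lies below point 1 in coordinate \<open>j\<close>
    is decided by their positions under \<open>\<pi> j\<close>.\<close>
  have order: "u \<in> E" if \<pi>: "\<pi> \<in> multi_perms m" and t: "t \<in> D m \<pi>" "t \<in> E" and u: "u \<in> D m \<pi>" for t u \<pi>
  proof -
    have "u i $ j < u 1 $ j" if i: "i \<in> {2..Suc (a j)}" for i j
    proof -
      have perm: "\<pi> j permutes {1..m}" using \<pi> by simp
      have "i \<in> {1..m}" "1 \<in> {1..m}" using i a_less[of j] by auto
      then obtain k l where kl: "k \<in> {1..m}" "i = \<pi> j k" "l \<in> {1..m}" "1 = \<pi> j l"
        using permutes_image[OF perm] by (metis imageE)
      have "t i $ j < t 1 $ j" using t(2) i by (auto simp: E_def)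
      then show ?thesis
        unfolding kl(2,4) using D_less_iff[OF t(1) kl(1,3)] D_less_iff[OF u kl(1,3)] by simp
    qed
    moreover have "u \<in> {1..m} \<rightarrow>\<^sub>E cube"
      using D_subset_cube \<pi> u by blast
    ultimately show ?thesis by (simp add: E_def)
  qed
  \<comment> \<open>The region left to point \<open>i\<close> once the first point is
    \<open>s\<close>. For \<open>s\<close> in the open cube it is a box, since
    \<open>s $ j < 1\<close> makes the bound 1 redundant in the constrained coordinates.\<close>
  define B where "B i s = {u \<in> box 0 1. \<forall>j. i \<le> Suc (a j) \<longrightarrow> u $ j < s $ j}" for i and s :: "(real, 'd) vec"
  have B_box: "B i s = box 0 (\<chi> j. if i \<le> Suc (a j) then s $ j else 1)" if "s \<in> box 0 1" for i s
  proof -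
    have "0 < u $ j \<and> u $ j < (if i \<le> Suc (a j) then s $ j else 1) \<longleftrightarrow>
        0 < u $ j \<and> u $ j < 1 \<and> (i \<le> Suc (a j) \<longrightarrow> u $ j < s $ j)" for u :: "(real, 'd) vec" and j
      using that by (auto simp: mem_box_cart intro: less_trans)
    then show ?thesis
      by (simp add: B_def mem_box_cart set_eq_iff) blast
  qed
  have B_measure: "measure lborel (B i s) = (\<Prod>j\<in>UNIV. if i \<le> Suc (a j) then s $ j else 1)"
    if "s \<in> box 0 1" for i s
  proof -
    let ?b = "\<chi> j. if i \<le> Suc (a j) then s $ j else 1"
    have "0 \<le> ?b $ j" for j using that by (simp add: mem_box_cart less_imp_le)
    then have "cbox 0 ?b \<noteq> {}"
      by (auto simp: interval_ne_empty_cart)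
    from content_cbox_cart[OF this] show ?thesis
      unfolding B_box[OF that] by (simp add: measure_lborel_box_eq measure_lborel_cbox_eq)
  qed
  \<comment> \<open>After exchanging the products, coordinate \<open>j\<close> receives
    \<open>s $ j\<close> once for each \<open>i\<close> from 2 to \<open>Suc (a j)\<close>.\<close>
  have count: "(\<Prod>i\<in>{2..m}. \<Prod>j\<in>UNIV. if i \<le> Suc (a j) then s $ j else 1) = (\<Prod>j\<in>UNIV. s $ j ^ a j)"
    for s :: "(real, 'd) vec"
  proof -
    have "(\<Prod>i\<in>{2..m}. if i \<le> Suc (a j) then s $ j else 1) = s $ j ^ a j" for j
    proof -
      have "{i \<in> {2..m}. i \<le> Suc (a j)} = {2..Suc (a j)}" using a_less[of j] by auto
      then show ?thesis by (simp add: prod.inter_filter[symmetric])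
    qed
    then show ?thesis by (subst prod.swap) simp
  qed
  have split: "{1..m} = {1} \<union> {2..m}" using m by auto
  let ?F = "\<lambda>t. indicat_real E t *\<^sub>R ?f t"
  have F_int: "integrable (multi_lborel m) ?F"
    using E_sets f_int by (rule integrable_mult_indicator)
  \<comment> \<open>For points in the open cube the condition \<open>E\<close> separates into one
    condition per point given \<open>t 1\<close>. If some point is outside, both sides
    vanish.\<close>
  have F_eq: "?F t = minor e x I (t 1) * (\<Prod>i\<in>{2..m}. indicat_real (B i (t 1)) (t i))"
    if "t \<in> space (multi_lborel m)" for t
  proof -
    have "?f t = minor e x I (t 1) * (\<Prod>i\<in>{2..m}. indicat_real (box 0 1) (t i))"
    proof -
      have "?f t = minor e x (P 1) (t 1) * (\<Prod>i\<in>{2..m}. minor e x (P i) (t i))"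
        unfolding split by (subst prod.union_disjoint) auto
      also have "(\<Prod>i\<in>{2..m}. minor e x (P i) (t i)) = (\<Prod>i\<in>{2..m}. indicat_real (box 0 1) (t i))"
        by (intro prod.cong) (auto simp: P_def minor_Inl)
      finally show ?thesis using m by (simp add: P_def)
    qed
    show ?thesis
    proof (cases "t 1 \<in> box 0 1 \<and> (\<forall>i\<in>{2..m}. t i \<in> box 0 1)")
      case True
      then have box: "\<forall>i\<in>{1..m}. t i \<in> box 0 1" unfolding split by auto
      have "t i \<in> cube" if "i \<in> {1..m}" for i
        unfolding cube_def using box that by (intro subsetD[OF box_subset_cbox]) auto
      then have "t \<in> {1..m} \<rightarrow>\<^sub>E cube"
        using that by (simp add: space_PiM PiE_iff)
      then have "t \<in> E \<longleftrightarrow> (\<forall>j. \<forall>i\<in>{2..Suc (a j)}. t i $ j < t 1 $ j)"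
        by (simp add: E_def)
      also have "\<dots> \<longleftrightarrow> (\<forall>i\<in>{2..m}. \<forall>j. i \<le> Suc (a j) \<longrightarrow> t i $ j < t 1 $ j)"
        using a_less by (metis atLeastAtMost_iff order_trans)
      also have "\<dots> \<longleftrightarrow> (\<forall>i\<in>{2..m}. t i \<in> B i (t 1))"
        using True by (simp add: B_def)
      finally have "indicat_real E t = (\<Prod>i\<in>{2..m}. indicat_real (B i (t 1)) (t i))"
        by (auto simp: indicator_def prod_zero_iff)
      then show ?thesis using True \<open>?f t = _\<close> by simp
    next
      case False
      then have f0: "?f t = 0" using \<open>?f t = _\<close> by (auto simp: minor_def prod_zero_iff indicator_def)
      have "minor e x I (t 1) * (\<Prod>i\<in>{2..m}. indicat_real (B i (t 1)) (t i)) = 0"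
        using False by (auto simp: minor_def prod_zero_iff indicator_def B_def)
      then show ?thesis unfolding f0 by (simp only: scaleR_zero_right)
    qed
  qed
  \<comment> \<open>Fubini with the first point as outer variable; \<open>merge\<close> reassembles
    the tuple.\<close>
  have "(LINT t:E|multi_lborel m. ?f t) =
      (LINT y|PiM {1 :: nat} (\<lambda>_. lborel). (LINT z|PiM {2..m} (\<lambda>_. lborel). ?F (merge {1} {2..m} (y, z))))"
    unfolding set_lebesgue_integral_def
    using product_integral_fold[of "{1}" "{2..m}" ?F] F_int unfolding split[symmetric] by simp
  also have "\<dots> = (LINT y|PiM {1 :: nat} (\<lambda>_. lborel). minor e x I (y 1) * (\<Prod>j\<in>UNIV. y 1 $ j ^ a j))"
  proof (rule Bochner_Integration.integral_cong[OF refl])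
    fix y assume y: "y \<in> space (PiM {1 :: nat} (\<lambda>_. lborel :: (real, 'd) vec measure))"
    have "(LINT z|PiM {2..m} (\<lambda>_. lborel). ?F (merge {1} {2..m} (y, z))) =
        (LINT z|PiM {2..m} (\<lambda>_. lborel). minor e x I (y 1) * (\<Prod>i\<in>{2..m}. indicat_real (B i (y 1)) (z i)))"
    proof (rule Bochner_Integration.integral_cong[OF refl])
      fix z assume z: "z \<in> space (PiM {2..m} (\<lambda>_. lborel :: (real, 'd) vec measure))"
      have "merge {1} {2..m} (y, z) \<in> space (multi_lborel m)"
        using y z unfolding split by (auto simp: space_PiM PiE_iff extensional_def merge_def)
      then have "?F (merge {1} {2..m} (y, z)) = minor e x I (merge {1} {2..m} (y, z) 1) *
          (\<Prod>i\<in>{2..m}. indicat_real (B i (merge {1} {2..m} (y, z) 1)) (merge {1} {2..m} (y, z) i))"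
        by (rule F_eq)
      also have "\<dots> = minor e x I (y 1) * (\<Prod>i\<in>{2..m}. indicat_real (B i (y 1)) (z i))"
      proof -
        have "merge {1} {2..m} (y, z) 1 = y 1" "\<And>i. i \<in> {2..m} \<Longrightarrow> merge {1} {2..m} (y, z) i = z i"
          by (auto simp: merge_def)
        then show ?thesis
          by (intro arg_cong2[where f = "(*)"] prod.cong) (simp_all only:)
      qed
      finally show "?F (merge {1} {2..m} (y, z)) = minor e x I (y 1) * (\<Prod>i\<in>{2..m}. indicat_real (B i (y 1)) (z i))" .
    qed
    also have "\<dots> = minor e x I (y 1) * (\<Prod>j\<in>UNIV. y 1 $ j ^ a j)"
    proof (cases "y 1 \<in> box 0 1")
      case True
      \<comment> \<open>Given the first point, the others range independently over their boxes, so
        the integral is the product of the volumes.\<close>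
      have "(LINT z|PiM {2..m} (\<lambda>_. lborel). (\<Prod>i\<in>{2..m}. indicat_real (B i (y 1)) (z i))) =
          (\<Prod>i\<in>{2..m}. measure lborel (B i (y 1)))"
        by (subst product_integral_prod)
          (use emeasure_bounded_finite[OF bounded_box] in \<open>auto simp: B_box[OF True] intro!: integrable_real_indicator\<close>)
      also have "\<dots> = (\<Prod>j\<in>UNIV. y 1 $ j ^ a j)"
        by (simp add: B_measure[OF True] count)
      finally show ?thesis by simp
    qed (simp add: minor_def)
    finally show "(LINT z|PiM {2..m} (\<lambda>_. lborel). ?F (merge {1} {2..m} (y, z))) =
        minor e x I (y 1) * (\<Prod>j\<in>UNIV. y 1 $ j ^ a j)" .
  qed
  also have "\<dots> = (LINT s|lborel. minor e x I s * (\<Prod>j\<in>UNIV. s $ j ^ a j))"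
    using minor_measurable[OF x I]
    by (intro product_integral_singleton)
      (auto intro!: borel_measurable_times borel_measurable_continuous_onI continuous_intros)
  finally have "(LINT s|lborel. minor e x I s * (\<Prod>j\<in>UNIV. s $ j ^ a j)) = (LINT t:E|multi_lborel m. ?f t)" ..
  also have "\<dots> = (\<Sum>\<pi> | \<pi> \<in> multi_perms m \<and> D m \<pi> \<subseteq> E. (LINT t:D m \<pi>|multi_lborel m. ?f t))"
  proof (rule integral_order_type[OF m f_int _ _ E_sets])
    show "E \<subseteq> {1..m} \<rightarrow>\<^sub>E cube"
      unfolding E_def by (rule Collect_restrict)
    show "u \<in> E" if "\<pi> \<in> multi_perms m" "t \<in> D m \<pi>" "u \<in> D m \<pi>" "t \<in> E" for t u \<pi>
      by (rule order[OF that(1,2,4,3)])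
  qed
  also have "\<dots> = (\<Sum>\<pi> | \<pi> \<in> multi_perms m \<and> D m \<pi> \<subseteq> E. signature n e x m (P, \<pi>))"
    by (intro sum.cong refl signature_eq[symmetric, OF x coords m P_W]) auto
  finally show ?thesis .
qed

text \<open>By \<open>signature_moment\<close> the moments of a minor depend on the map only through
  its signature, so the difference of the two minors has vanishing moments.\<close>

lemma jacobian_equiv_if_signature_eq:
  fixes x y :: "real ^ 'd::{finite,linorder} \<Rightarrow> 'v"
  assumes x: "x \<in> Lip" and y: "y \<in> Lip" and eq: "signature n e x = signature n e y"
  shows "(x, y) \<in> jacobian_equiv n e"
proof -
  have "AE s in lborel. minor e x I s = minor e y I s" if I: "I \<in> W n" for I
  proof -
    let ?h = "\<lambda>s. minor e x I s - minor e y I s"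
    have mono: "continuous_on UNIV (\<lambda>s :: (real, 'd) vec. \<Prod>j\<in>UNIV. s $ j ^ a j)" for a :: "'d \<Rightarrow> nat"
      by (intro continuous_intros)
    have int: "integrable lborel (\<lambda>s. minor e z I s * (\<Prod>j\<in>UNIV. s $ j ^ a j))" if z: "z \<in> Lip" for z :: "(real, 'd) vec \<Rightarrow> 'v" and a
    proof (rule Bochner_Integration.integrable_bound[OF minor_integrable[OF z I]])
      show "(\<lambda>s. minor e z I s * (\<Prod>j\<in>UNIV. s $ j ^ a j)) \<in> borel_measurable lborel"
        using minor_measurable[OF z I] borel_measurable_continuous_onI[OF mono[of a]] by simp
      have "\<bar>\<Prod>j\<in>UNIV. s $ j ^ a j\<bar> \<le> 1" if "s \<in> box 0 1" for s :: "(real, 'd) vec"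
      proof -
        have "0 \<le> s $ j \<and> s $ j \<le> 1" for j using that by (simp add: mem_box_cart less_imp_le)
        then show ?thesis
          unfolding abs_prod by (intro prod_le_1) (simp add: power_le_one)
      qed
      then show "AE s in lborel. norm (minor e z I s * (\<Prod>j\<in>UNIV. s $ j ^ a j)) \<le> norm (minor e z I s)"
        by (intro AE_I2) (auto simp: minor_def abs_mult intro!: mult_left_le)
    qed
    have "AE s in lborel. ?h s = 0"
    proof (rule AE_zero_if_moments_zero)
      show "compact (cube :: (real, 'd) vec set)" by (simp add: cube_def compact_cbox)
      show "set_integrable lborel cube ?h"
        unfolding set_integrable_def using minor_integrable[OF x I] minor_integrable[OF y I]
        by (intro integrable_mult_indicator Bochner_Integration.integrable_diff) (auto simp: cube_def)
      show "?h s = 0" if "s \<notin> cube" for s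
        using that box_subset_cbox[of 0 "1 :: (real, 'd) vec"] by (auto simp: minor_def cube_def)
      show "(LINT s|lborel. ?h s * (\<Prod>j\<in>UNIV. s $ j ^ a j)) = 0" for a
        using int[OF x, of a] int[OF y, of a]
        by (simp add: left_diff_distrib signature_moment[OF x I] signature_moment[OF y I] eq)
    qed
    then show ?thesis by eventually_elim simp
  qed
  then show ?thesis using x y by (simp add: jacobian_equiv_iff_minor)
qed

section \<open>Square summability\<close>

text \<open>With \<open>L\<close> bounding the minors and \<open>K\<close> form indices, level
  \<open>m\<close> has \<open>K ^ m\<close> words, and each contributes at most
  \<open>(L ^ 2) ^ m / fact m\<close>. The sum over the levels is dominated by an exponential
  series.\<close>

lemma signature_in_H:
  fixes x :: "real ^ 'd::{finite,linorder} \<Rightarrow> 'v"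
  assumes x: "x \<in> Lip"
  shows "signature n e x \<in> H n"
proof -
  obtain L where L: "L \<ge> 0" "\<And>I s. I \<in> W n \<Longrightarrow> \<bar>minor e x I s\<bar> \<le> L"
    using minor_bounded[OF x] by metis
  have fin_forms: "finite (form_indices n :: ('d \<Rightarrow> 'd + nat) set)"
  proof (rule finite_subset)
    show "form_indices n \<subseteq> PiE UNIV (\<lambda>_ :: 'd. (UNIV :: 'd set) <+> {1..n})"
      by (auto simp: form_indices_def PiE_UNIV_domain Pi_def)
    show "finite (PiE UNIV (\<lambda>_ :: 'd. (UNIV :: 'd set) <+> {1..n}))"
      by (intro finite_PiE) auto
  qed
  define K where "K = card (form_indices n :: ('d \<Rightarrow> 'd + nat) set)"
  have bound: "\<bar>signature n e x m (P, \<pi>)\<bar> \<le> L ^ m * measure (multi_lborel m) (D m \<pi>)"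
    if m: "1 \<le> m" and P\<pi>: "(P, \<pi>) \<in> coords n m" for m P \<pi>
  proof (cases "\<forall>i\<in>{1..m}. P i \<in> W n")
    case True
    have \<pi>: "\<pi> j permutes {1..m}" for j using P\<pi> by (auto simp: coords_def)
    let ?f = "\<lambda>t. \<Prod>i\<in>{1..m}. minor e x (P i) (t i)"
    have D: "D m \<pi> \<in> sets (multi_lborel m)" by (rule sets_D[OF \<pi> m])
    have C: "{1..m} \<rightarrow>\<^sub>E (cube :: (real, 'd) vec set) \<in> sets (multi_lborel m)"
      by (intro sets_PiM_I_finite) (auto simp: cube_def)
    have "emeasure (multi_lborel m) (D m \<pi>) \<le> 1"
      using emeasure_mono[OF D_subset_cube[OF \<pi>] C] by (simp add: emeasure_multi_cube)
    then have D_fin: "emeasure (multi_lborel m) (D m \<pi>) < \<infinity>"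
      using order_le_less_trans[OF _ ennreal_one_less_top] by simp
    have "\<bar>signature n e x m (P, \<pi>)\<bar> = norm (LINT t:D m \<pi>|multi_lborel m. ?f t)"
      using signature_eq[OF x P\<pi> m] True by simp
    also have "\<dots> \<le> (LINT t|multi_lborel m. L ^ m * indicat_real (D m \<pi>) t)"
      unfolding set_lebesgue_integral_def
    proof (rule order_trans[OF integral_norm_bound integral_mono])
      show "integrable (multi_lborel m) (\<lambda>t. norm (indicat_real (D m \<pi>) t *\<^sub>R ?f t))"
        using True by (intro integrable_norm integrable_mult_indicator D integrable_prod_minor x) auto
      show "integrable (multi_lborel m) (\<lambda>t. L ^ m * indicat_real (D m \<pi>) t)"
        using D D_fin by (intro integrable_mult_right integrable_real_indicator) auto
      have "\<bar>?f t\<bar> \<le> L ^ m" for t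
      proof -
        have "\<bar>?f t\<bar> \<le> (\<Prod>i\<in>{1..m}. L)"
          unfolding abs_prod using L True by (intro prod_mono) auto
        then show ?thesis by simp
      qed
      then show "norm (indicat_real (D m \<pi>) t *\<^sub>R ?f t) \<le> L ^ m * indicat_real (D m \<pi>) t" for t
        by (auto simp: indicator_def)
    qed
    also have "\<dots> = L ^ m * measure (multi_lborel m) (D m \<pi>)"
      using D by simp
    finally show ?thesis .
  next
    case False
    then have "signature n e x m (P, \<pi>) = 0"
      using m P\<pi> by (auto simp: signature_def)
    then show ?thesis using L(1) by simp
  qed
  \<comment> \<open>In the squared volume of \<open>D m \<pi>\<close> one factor is estimated by
    \<open>1 / fact m\<close>; the other is kept, since these volumes sum to at most 1 over all
    order types.\<close>
  have level: "(\<Sum>k\<in>coords n m. (signature n e x m k)\<^sup>2) \<le> (real K * L\<^sup>2) ^ m / fact m" if m: "1 \<le> m" for m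
  proof -
    let ?v = "\<lambda>\<pi>. measure (multi_lborel m) (D m \<pi> :: (nat \<Rightarrow> (real, 'd) vec) set)"
    have sq: "(signature n e x m (P, \<pi>))\<^sup>2 \<le> (L\<^sup>2) ^ m / fact m * ?v \<pi>" if k: "(P, \<pi>) \<in> coords n m" for P \<pi>
    proof -
      have \<pi>: "\<pi> \<in> multi_perms m" using k by (auto simp: coords_def)
      have "(signature n e x m (P, \<pi>))\<^sup>2 \<le> (L ^ m * ?v \<pi>)\<^sup>2"
        using power_mono[OF bound[OF m k], of 2] by simp
      also have "\<dots> = (L\<^sup>2) ^ m * ?v \<pi> * ?v \<pi>"
        by (simp add: power2_eq_square power_mult_distrib mult_ac)
      also have "\<dots> \<le> (L\<^sup>2) ^ m * ?v \<pi> * (1 / fact m)"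
        using measure_D_le[OF m \<pi>] by (intro mult_left_mono) auto
      finally show ?thesis by (simp add: mult_ac)
    qed
    have "(\<Sum>k\<in>coords n m. (signature n e x m k)\<^sup>2) =
        (\<Sum>P\<in>{1..m} \<rightarrow>\<^sub>E form_indices n. \<Sum>\<pi>\<in>multi_perms m. (signature n e x m (P, \<pi>))\<^sup>2)"
      by (simp add: coords_def sum.cartesian_product)
    also have "\<dots> \<le> (\<Sum>P\<in>{1..m} \<rightarrow>\<^sub>E (form_indices n :: ('d \<Rightarrow> 'd + nat) set). \<Sum>\<pi>\<in>multi_perms m. (L\<^sup>2) ^ m / fact m * ?v \<pi>)"
      by (intro sum_mono sq) (auto simp: coords_def)
    also have "\<dots> = real K ^ m * ((L\<^sup>2) ^ m / fact m * (\<Sum>\<pi>\<in>multi_perms m. ?v \<pi>))"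
      by (simp add: sum_distrib_left card_PiE K_def)
    also have "\<dots> \<le> real K ^ m * ((L\<^sup>2) ^ m / fact m * 1)"
      using sum_measure_D_le[OF m subset_refl] by (intro mult_left_mono) auto
    also have "\<dots> = (real K * L\<^sup>2) ^ m / fact m"
      by (simp add: power_mult_distrib)
    finally show ?thesis .
  qed
  have "summable (\<lambda>m. (real K * L\<^sup>2) ^ m / fact m)"
    using summable_exp[of "real K * L\<^sup>2"] by (simp add: divide_inverse mult.commute)
  then have "summable (\<lambda>m. \<Sum>k\<in>coords n m. (signature n e x m k)\<^sup>2)"
    \<comment> \<open>The comparison starts at 1 because the estimate concerns positive levels; the
      single level 0 does not affect convergence.\<close>
    by (rule summable_comparison_test'[where N = 1]) (use level in \<open>simp add: sum_nonneg\<close>)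
  moreover have "signature n e x m \<in> T_level n m" for m
    by (auto simp: T_level_def signature_def)
  ultimately show ?thesis by (simp add: H_def)
qed

end

theorem theorem3:
  fixes n :: nat and e :: "nat \<Rightarrow> 'v::real_inner"
  assumes "orthonormal_basis n e"
  shows "signature_J n e \<in> (Lip_J n e :: (real ^ 'd::{finite,linorder} \<Rightarrow> 'v) set set) \<rightarrow> H n \<and>
         inj_on (signature_J n e) (Lip_J n e :: (real ^ 'd::{finite,linorder} \<Rightarrow> 'v) set set)"
proof (intro conjI Pi_I inj_onI)
  fix c :: "(real ^ 'd::{finite,linorder} \<Rightarrow> 'v) set" assume "c \<in> Lip_J n e"
  then show "signature_J n e c \<in> H n"
    unfolding Lip_J_def
    by (auto elim!: quotientE simp: signature_J_class[OF assms] signature_in_H[OF assms])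
next
  fix c c' :: "(real ^ 'd::{finite,linorder} \<Rightarrow> 'v) set"
  assume "c \<in> Lip_J n e" "c' \<in> Lip_J n e" and eq: "signature_J n e c = signature_J n e c'"
  then obtain x y where xy: "x \<in> Lip" "c = jacobian_equiv n e `` {x}" "y \<in> Lip" "c' = jacobian_equiv n e `` {y}"
    unfolding Lip_J_def by (auto elim!: quotientE)
  \<comment> \<open>The value on a class is the signature of any representative, so equality of the
    values gives equal signatures of \<open>x\<close> and \<open>y\<close>.\<close>
  then have "(x, y) \<in> jacobian_equiv n e"
    using eq by (intro jacobian_equiv_if_signature_eq[OF assms]) (auto simp: signature_J_class[OF assms])
  then show "c = c'"
    unfolding xy by (rule equiv_class_eq[OF equiv_jacobian_equiv[OF assms]])
qed

end
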